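(* Let $M\models\mathsf{ZFA}$ with SD-graph $M_0$. There is a countable $\{S,D\}$-structure $N\equiv M_0$ such that the reduct $N\upharpoonright\{D\}$ has no connected component of infinite diameter.
   Context: The ambient metatheory is $\mathsf{ZFC}+\mathrm{Con}(\mathsf{ZFC})$. $\mathsf{ZFA}$ is $\mathsf{ZFC}$ with Foundation replaced by the Anti-Foundation Axiom (every flat system of equations has a unique solution). For an $\{\in\}$-structure $M$, $S(x,y)$ denotes $x\in y\vee y\in x$ and $D(x,y)$ denotes $x\in y\wedge y\in x$; the SD-graph $M_0$ is the reduct of $M$ to $\{S,D\}$. Connected components and diameters of $N\upharpoonright\{D\}$ refer to the graph whose edge relation is $D$, with graph distance. *)

theory Defs
  imports Main "HOL-Library.Extended_Nat" "HOL-Library.Countable_Set"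
begin

section \<open>First-order logic with equality over binary relation symbols\<close>

text \<open>Variables are de Bruijn indices: in \<open>Forall p\<close>, index 0 of \<open>p\<close> is the bound variable and
  index \<open>Suc n\<close> of \<open>p\<close> is index \<open>n\<close> outside.\<close>

datatype 'r fm =
    Rel 'r nat nat
  | Eq nat nat
  | Neg "'r fm"
  | Conj "'r fm" "'r fm"
  | Forall "'r fm"

definition Disj :: "'r fm \<Rightarrow> 'r fm \<Rightarrow> 'r fm" where
  "Disj p q = Neg (Conj (Neg p) (Neg q))"

definition Imp :: "'r fm \<Rightarrow> 'r fm \<Rightarrow> 'r fm" where
  "Imp p q = Neg (Conj p (Neg q))"

definition Iff :: "'r fm \<Rightarrow> 'r fm \<Rightarrow> 'r fm" where
  "Iff p q = Conj (Imp p q) (Imp q p)"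

definition Exists :: "'r fm \<Rightarrow> 'r fm" where
  "Exists p = Neg (Forall (Neg p))"

primrec fv :: "'r fm \<Rightarrow> nat set" where
  "fv (Rel r i j) = {i, j}"
| "fv (Eq i j) = {i, j}"
| "fv (Neg p) = fv p"
| "fv (Conj p q) = fv p \<union> fv q"
| "fv (Forall p) = {n. Suc n \<in> fv p}"

text \<open>Renaming of the free variables.\<close>

primrec ren :: "(nat \<Rightarrow> nat) \<Rightarrow> 'r fm \<Rightarrow> 'r fm" where
  "ren f (Rel r i j) = Rel r (f i) (f j)"
| "ren f (Eq i j) = Eq (f i) (f j)"
| "ren f (Neg p) = Neg (ren f p)"
| "ren f (Conj p q) = Conj (ren f p) (ren f q)"
| "ren f (Forall p) = Forall (ren (case_nat 0 (\<lambda>n. Suc (f n))) p)"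

record ('r, 'a) struc =
  universe :: "'a set"
  interp :: "'r \<Rightarrow> 'a \<Rightarrow> 'a \<Rightarrow> bool"

primrec sat :: "('r, 'a) struc \<Rightarrow> (nat \<Rightarrow> 'a) \<Rightarrow> 'r fm \<Rightarrow> bool" where
  "sat M e (Rel r i j) = interp M r (e i) (e j)"
| "sat M e (Eq i j) = (e i = e j)"
| "sat M e (Neg p) = (\<not> sat M e p)"
| "sat M e (Conj p q) = (sat M e p \<and> sat M e q)"
| "sat M e (Forall p) = (\<forall>a\<in>universe M. sat M (case_nat a e) p)"

lemma sat_derived [simp]:
  "sat M e (Disj p q) \<longleftrightarrow> sat M e p \<or> sat M e q"
  "sat M e (Imp p q) \<longleftrightarrow> (sat M e p \<longrightarrow> sat M e q)"
  "sat M e (Iff p q) \<longleftrightarrow> (sat M e p \<longleftrightarrow> sat M e q)"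
  "sat M e (Exists p) \<longleftrightarrow> (\<exists>a\<in>universe M. sat M (case_nat a e) p)"
  by (auto simp: Disj_def Imp_def Iff_def Exists_def)

text \<open>A formula with free variables is true in \<open>M\<close> if its universal closure is.\<close>

definition true_in :: "('r, 'a) struc \<Rightarrow> 'r fm \<Rightarrow> bool" where
  "true_in M p \<longleftrightarrow> (\<forall>e. range e \<subseteq> universe M \<longrightarrow> sat M e p)"

definition models :: "('r, 'a) struc \<Rightarrow> 'r fm set \<Rightarrow> bool" where
  "models M T \<longleftrightarrow> (\<forall>p\<in>T. true_in M p)"

definition elem_equiv :: "('r, 'a) struc \<Rightarrow> ('r, 'b) struc \<Rightarrow> bool" where
  "elem_equiv M N \<longleftrightarrow> (\<forall>p. fv p = {} \<longrightarrow> (true_in M p \<longleftrightarrow> true_in N p))"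

lemma sat_ren: "sat M e (ren f p) \<longleftrightarrow> sat M (\<lambda>n. e (f n)) p"
proof (induction p arbitrary: e f)
  case (Forall p)
  have "(\<lambda>n. case_nat a e (case_nat 0 (\<lambda>n. Suc (f n)) n)) = case_nat a (\<lambda>n. e (f n))" for a
    by (auto split: nat.split)
  with Forall show ?case by simp
qed simp_all


section \<open>The theory ZFA\<close>

datatype mem = Mem_rel

abbreviation Mem :: "nat \<Rightarrow> nat \<Rightarrow> mem fm" where
  "Mem \<equiv> Rel Mem_rel"

text \<open>Bounded quantifiers: index 0 of \<open>p\<close> ranges over the elements of the outer variable \<open>i\<close>.\<close>

definition BAll :: "nat \<Rightarrow> mem fm \<Rightarrow> mem fm" where
  "BAll i p = Forall (Imp (Mem 0 (Suc i)) p)"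

definition BEx :: "nat \<Rightarrow> mem fm \<Rightarrow> mem fm" where
  "BEx i p = Exists (Conj (Mem 0 (Suc i)) p)"

lemma sat_bounded [simp]:
  "sat M e (BAll i p) \<longleftrightarrow>
     (\<forall>a\<in>universe M. interp M Mem_rel a (e i) \<longrightarrow> sat M (case_nat a e) p)"
  "sat M e (BEx i p) \<longleftrightarrow>
     (\<exists>a\<in>universe M. interp M Mem_rel a (e i) \<and> sat M (case_nat a e) p)"
  by (simp_all add: BAll_def BEx_def)

lemma ex1_in_iff: "(\<exists>!y. y \<in> U \<and> P y) \<longleftrightarrow> (\<exists>y\<in>U. \<forall>z\<in>U. P z \<longleftrightarrow> z = y)"
  by metis

definition ax_ext :: "mem fm" where
  "ax_ext = Forall (Forall (Imp (Forall (Iff (Mem 0 2) (Mem 0 1))) (Eq 1 0)))"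

definition ax_pair :: "mem fm" where
  "ax_pair = Forall (Forall (Exists (Forall (Iff (Mem 0 1) (Disj (Eq 0 3) (Eq 0 2))))))"

definition ax_union :: "mem fm" where
  "ax_union = Forall (Exists (Forall (Iff (Mem 0 1) (BEx 2 (Mem 1 0)))))"

definition ax_power :: "mem fm" where
  "ax_power = Forall (Exists (Forall (Iff (Mem 0 1) (BAll 0 (Mem 0 3)))))"

definition ax_infinity :: "mem fm" where
  "ax_infinity = Exists (Conj (BEx 0 (Forall (Neg (Mem 0 1))))
     (BAll 0 (BEx 1 (Forall (Iff (Mem 0 1) (Disj (Mem 0 2) (Eq 0 2)))))))"

definition ax_choice :: "mem fm" where
  "ax_choice = Forall (Imp
     (Conj (BAll 0 (Exists (Mem 0 1)))
           (BAll 0 (BAll 1 (Imp (Exists (Conj (Mem 0 2) (Mem 0 1))) (Eq 1 0)))))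
     (Exists (BAll 1 (Exists (Forall (Iff (Conj (Mem 0 2) (Mem 0 3)) (Eq 0 1)))))))"

text \<open>In \<open>ax_separation p\<close>, index 0 of \<open>p\<close> is the element being tested, and index \<open>Suc n\<close> of \<open>p\<close>
  is the free variable \<open>n\<close> of the instance; variable 0 of the instance is the set separated from.\<close>

definition ax_separation :: "mem fm \<Rightarrow> mem fm" where
  "ax_separation p =
     Exists (Forall (Iff (Mem 0 1) (Conj (Mem 0 2) (ren (case_nat 0 (\<lambda>n. n + 2)) p))))"

text \<open>In \<open>ax_replacement p\<close>, indices 0 and 1 of \<open>p\<close> are the argument and the value, and index
  \<open>n + 2\<close> of \<open>p\<close> is the free variable \<open>n\<close> of the instance; variable 0 of the instance is the
  set whose image is taken.\<close>

definition ax_replacement :: "mem fm \<Rightarrow> mem fm" where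
  "ax_replacement p = Imp
     (BAll 0 (Forall (Forall (Imp
        (Conj (ren (case_nat 2 (case_nat 1 (\<lambda>n. n + 3))) p)
              (ren (case_nat 2 (case_nat 0 (\<lambda>n. n + 3))) p))
        (Eq 1 0)))))
     (Exists (Forall (Iff (Mem 0 1)
        (BEx 2 (ren (case_nat 0 (case_nat 1 (\<lambda>n. n + 3))) p)))))"

subsection \<open>The Anti-Foundation Axiom\<close>

text \<open>\<open>p = {a, b}\<close>, \<open>p = (a, b)\<close> (Kuratowski), and \<open>(a, b) \<in> f\<close>:\<close>

definition fm_upair :: "nat \<Rightarrow> nat \<Rightarrow> nat \<Rightarrow> mem fm" where
  "fm_upair p a b = Forall (Iff (Mem 0 (Suc p)) (Disj (Eq 0 (Suc a)) (Eq 0 (Suc b))))"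

definition fm_opair :: "nat \<Rightarrow> nat \<Rightarrow> nat \<Rightarrow> mem fm" where
  "fm_opair p a b = Exists (Exists (Conj (fm_upair 1 (a + 2) (a + 2))
     (Conj (fm_upair 0 (a + 2) (b + 2)) (fm_upair (p + 2) 1 0))))"

definition fm_app :: "nat \<Rightarrow> nat \<Rightarrow> nat \<Rightarrow> mem fm" where
  "fm_app f a b = BEx f (fm_opair 0 (Suc a) (Suc b))"

text \<open>\<open>f\<close> is a function with domain \<open>X\<close>:\<close>

definition fm_function :: "nat \<Rightarrow> nat \<Rightarrow> mem fm" where
  "fm_function f X = Conj
     (BAll f (BEx (X + 1) (Exists (fm_opair 2 1 0))))
     (BAll X (Exists (Forall (Iff (fm_app (f + 3) 2 0) (Eq 0 1)))))"

text \<open>A flat system with indeterminates \<open>X\<close> and set of sets \<open>A\<close> (disjoint from \<open>X\<close>, so that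
  indeterminates can be told apart from the members of \<open>A\<close>) is coded by the function \<open>s\<close> on \<open>X\<close>
  taking \<open>x\<close> to the right-hand side \<open>S\<^sub>x \<subseteq> X \<union> A\<close> of its equation.\<close>

definition fm_flat_system :: "nat \<Rightarrow> nat \<Rightarrow> nat \<Rightarrow> mem fm" where
  "fm_flat_system X A s = Conj (fm_function s X)
     (Conj (BAll X (Neg (Mem 0 (A + 1))))
       (BAll X (Forall (Imp (fm_app (s + 2) 1 0)
          (BAll 0 (Disj (Mem 0 (X + 3)) (Mem 0 (A + 3))))))))"

text \<open>A solution is a function \<open>f\<close> on \<open>X\<close> with
  \<open>f(x) = {f(y) | y \<in> S\<^sub>x \<inter> X} \<union> (S\<^sub>x \<inter> A)\<close> for all \<open>x \<in> X\<close>.\<close>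

definition fm_solution :: "nat \<Rightarrow> nat \<Rightarrow> nat \<Rightarrow> nat \<Rightarrow> mem fm" where
  "fm_solution X A s f = Conj (fm_function f X)
     (BAll X (Forall (Forall (Imp (Conj (fm_app (s + 3) 2 1) (fm_app (f + 3) 2 0))
        (Forall (Iff (Mem 0 1)
           (Disj (BEx 2 (Conj (Mem 0 (X + 5)) (fm_app (f + 5) 0 1)))
                 (Conj (Mem 0 2) (Mem 0 (A + 4))))))))))"

definition ax_afa :: "mem fm" where
  "ax_afa = Forall (Forall (Forall (Imp (fm_flat_system 2 1 0)
     (Exists (Forall (Iff (fm_solution 4 3 2 0) (Eq 0 1)))))))"

definition ZFA :: "mem fm set" where
  "ZFA = {ax_ext, ax_pair, ax_union, ax_power, ax_infinity, ax_choice, ax_afa}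
     \<union> range ax_separation \<union> range ax_replacement"

subsection \<open>What the axioms say in a structure\<close>

abbreviation in_str :: "(mem, 'a) struc \<Rightarrow> 'a \<Rightarrow> 'a \<Rightarrow> bool" where
  "in_str M \<equiv> interp M Mem_rel"

definition is_upair :: "(mem, 'a) struc \<Rightarrow> 'a \<Rightarrow> 'a \<Rightarrow> 'a \<Rightarrow> bool" where
  "is_upair M p a b \<longleftrightarrow> (\<forall>z\<in>universe M. in_str M z p \<longleftrightarrow> z = a \<or> z = b)"

definition is_opair :: "(mem, 'a) struc \<Rightarrow> 'a \<Rightarrow> 'a \<Rightarrow> 'a \<Rightarrow> bool" where
  "is_opair M p a b \<longleftrightarrow>
     (\<exists>u\<in>universe M. \<exists>v\<in>universe M. is_upair M u a a \<and> is_upair M v a b \<and> is_upair M p u v)"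

definition is_app :: "(mem, 'a) struc \<Rightarrow> 'a \<Rightarrow> 'a \<Rightarrow> 'a \<Rightarrow> bool" where
  "is_app M f a b \<longleftrightarrow> (\<exists>p\<in>universe M. in_str M p f \<and> is_opair M p a b)"

definition is_function :: "(mem, 'a) struc \<Rightarrow> 'a \<Rightarrow> 'a \<Rightarrow> bool" where
  "is_function M f X \<longleftrightarrow>
     (\<forall>p\<in>universe M. in_str M p f \<longrightarrow> (\<exists>x\<in>universe M. in_str M x X \<and> (\<exists>y\<in>universe M. is_opair M p x y))) \<and>
     (\<forall>x\<in>universe M. in_str M x X \<longrightarrow> (\<exists>!y. y \<in> universe M \<and> is_app M f x y))"

definition is_flat_system :: "(mem, 'a) struc \<Rightarrow> 'a \<Rightarrow> 'a \<Rightarrow> 'a \<Rightarrow> bool" where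
  "is_flat_system M X A s \<longleftrightarrow> is_function M s X \<and>
     (\<forall>x\<in>universe M. in_str M x X \<longrightarrow> \<not> in_str M x A) \<and>
     (\<forall>x\<in>universe M. in_str M x X \<longrightarrow> (\<forall>t\<in>universe M. is_app M s x t \<longrightarrow>
        (\<forall>z\<in>universe M. in_str M z t \<longrightarrow> in_str M z X \<or> in_str M z A)))"

definition is_solution :: "(mem, 'a) struc \<Rightarrow> 'a \<Rightarrow> 'a \<Rightarrow> 'a \<Rightarrow> 'a \<Rightarrow> bool" where
  "is_solution M X A s f \<longleftrightarrow> is_function M f X \<and>
     (\<forall>x\<in>universe M. in_str M x X \<longrightarrow> (\<forall>t\<in>universe M. \<forall>w\<in>universe M. is_app M s x t \<and> is_app M f x w \<longrightarrow>
        (\<forall>z\<in>universe M. in_str M z w \<longleftrightarrow>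
           (\<exists>y\<in>universe M. in_str M y t \<and> in_str M y X \<and> is_app M f y z) \<or>
           in_str M z t \<and> in_str M z A)))"

lemma sat_fm_upair [simp]: "sat M e (fm_upair p a b) \<longleftrightarrow> is_upair M (e p) (e a) (e b)"
  by (auto simp: fm_upair_def is_upair_def)

lemma sat_fm_opair [simp]: "sat M e (fm_opair p a b) \<longleftrightarrow> is_opair M (e p) (e a) (e b)"
  by (simp add: fm_opair_def is_opair_def)

lemma sat_fm_app [simp]: "sat M e (fm_app f a b) \<longleftrightarrow> is_app M (e f) (e a) (e b)"
  by (simp add: fm_app_def is_app_def)

lemma sat_fm_function [simp]: "sat M e (fm_function f X) \<longleftrightarrow> is_function M (e f) (e X)"
  by (simp add: fm_function_def is_function_def ex1_in_iff numeral_eq_Suc)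

lemma sat_fm_flat_system [simp]:
  "sat M e (fm_flat_system X A s) \<longleftrightarrow> is_flat_system M (e X) (e A) (e s)"
  by (simp add: fm_flat_system_def is_flat_system_def numeral_eq_Suc)

lemma sat_fm_solution [simp]:
  "sat M e (fm_solution X A s f) \<longleftrightarrow> is_solution M (e X) (e A) (e s) (e f)"
  by (simp add: fm_solution_def is_solution_def numeral_eq_Suc)

lemma sat_ax_ext: "sat M e ax_ext \<longleftrightarrow>
  (\<forall>x\<in>universe M. \<forall>y\<in>universe M. (\<forall>z\<in>universe M. in_str M z x \<longleftrightarrow> in_str M z y) \<longrightarrow> x = y)"
  by (simp add: ax_ext_def numeral_eq_Suc)

lemma sat_ax_pair: "sat M e ax_pair \<longleftrightarrow>
  (\<forall>a\<in>universe M. \<forall>b\<in>universe M. \<exists>p\<in>universe M. \<forall>z\<in>universe M. in_str M z p \<longleftrightarrow> z = a \<or> z = b)"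
  by (simp add: ax_pair_def numeral_eq_Suc)

lemma sat_ax_union: "sat M e ax_union \<longleftrightarrow>
  (\<forall>a\<in>universe M. \<exists>u\<in>universe M. \<forall>z\<in>universe M. in_str M z u \<longleftrightarrow> (\<exists>y\<in>universe M. in_str M y a \<and> in_str M z y))"
  by (simp add: ax_union_def numeral_eq_Suc)

lemma sat_ax_power: "sat M e ax_power \<longleftrightarrow>
  (\<forall>a\<in>universe M. \<exists>p\<in>universe M. \<forall>z\<in>universe M. in_str M z p \<longleftrightarrow> (\<forall>y\<in>universe M. in_str M y z \<longrightarrow> in_str M y a))"
  by (simp add: ax_power_def numeral_eq_Suc)

lemma sat_ax_infinity: "sat M e ax_infinity \<longleftrightarrow>
  (\<exists>w\<in>universe M. (\<exists>o'\<in>universe M. in_str M o' w \<and> (\<forall>z\<in>universe M. \<not> in_str M z o')) \<and>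
     (\<forall>x\<in>universe M. in_str M x w \<longrightarrow> (\<exists>y\<in>universe M. in_str M y w \<and>
        (\<forall>z\<in>universe M. in_str M z y \<longleftrightarrow> in_str M z x \<or> z = x))))"
  by (simp add: ax_infinity_def numeral_eq_Suc)

lemma sat_ax_choice: "sat M e ax_choice \<longleftrightarrow>
  (\<forall>a\<in>universe M.
     (\<forall>x\<in>universe M. in_str M x a \<longrightarrow> (\<exists>z\<in>universe M. in_str M z x)) \<and>
     (\<forall>x\<in>universe M. in_str M x a \<longrightarrow> (\<forall>y\<in>universe M. in_str M y a \<longrightarrow>
        (\<exists>z\<in>universe M. in_str M z x \<and> in_str M z y) \<longrightarrow> x = y)) \<longrightarrow>
     (\<exists>c\<in>universe M. \<forall>x\<in>universe M. in_str M x a \<longrightarrow>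
        (\<exists>!z. z \<in> universe M \<and> in_str M z x \<and> in_str M z c)))"
  by (simp add: ax_choice_def ex1_in_iff numeral_eq_Suc)

lemma sat_ax_afa: "sat M e ax_afa \<longleftrightarrow>
  (\<forall>X\<in>universe M. \<forall>A\<in>universe M. \<forall>s\<in>universe M. is_flat_system M X A s \<longrightarrow>
     (\<exists>!f. f \<in> universe M \<and> is_solution M X A s f))"
  by (simp add: ax_afa_def ex1_in_iff numeral_eq_Suc)

lemma sat_ax_separation: "sat M e (ax_separation p) \<longleftrightarrow>
  (\<exists>b\<in>universe M. \<forall>x\<in>universe M. in_str M x b \<longleftrightarrow> in_str M x (e 0) \<and> sat M (case_nat x e) p)"
proof -
  have *: "(\<lambda>n. case_nat x (case_nat b e) (case_nat 0 (\<lambda>n. n + 2) n)) = case_nat x e" for x b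
    by (auto split: nat.split simp: fun_eq_iff numeral_eq_Suc)
  show ?thesis
    unfolding ax_separation_def sat.simps sat_derived sat_ren *
    by (simp add: numeral_eq_Suc)
qed

lemma sat_ax_replacement: "sat M e (ax_replacement p) \<longleftrightarrow>
  ((\<forall>x\<in>universe M. in_str M x (e 0) \<longrightarrow> (\<forall>y\<in>universe M. \<forall>y'\<in>universe M.
      sat M (case_nat x (case_nat y e)) p \<and> sat M (case_nat x (case_nat y' e)) p \<longrightarrow> y = y')) \<longrightarrow>
   (\<exists>b\<in>universe M. \<forall>y\<in>universe M. in_str M y b \<longleftrightarrow>
      (\<exists>x\<in>universe M. in_str M x (e 0) \<and> sat M (case_nat x (case_nat y e)) p)))"
proof -
  have 1: "(\<lambda>n. case_nat y' (case_nat y (case_nat x e)) (case_nat 2 (case_nat 1 (\<lambda>n. n + 3)) n))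
      = case_nat x (case_nat y e)" for x y y'
    by (auto split: nat.split simp: fun_eq_iff numeral_eq_Suc)
  have 2: "(\<lambda>n. case_nat y' (case_nat y (case_nat x e)) (case_nat 2 (case_nat 0 (\<lambda>n. n + 3)) n))
      = case_nat x (case_nat y' e)" for x y y'
    by (auto split: nat.split simp: fun_eq_iff numeral_eq_Suc)
  have 3: "(\<lambda>n. case_nat x (case_nat y (case_nat b e)) (case_nat 0 (case_nat 1 (\<lambda>n. n + 3)) n))
      = case_nat x (case_nat y e)" for x y b
    by (auto split: nat.split simp: fun_eq_iff numeral_eq_Suc)
  show ?thesis
    unfolding ax_replacement_def sat.simps sat_derived sat_bounded sat_ren 1 2 3
    by (simp add: numeral_eq_Suc)
qed


section \<open>SD-graphs\<close>

datatype sd = S_rel | D_rel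

definition sd_graph :: "(mem, 'a) struc \<Rightarrow> (sd, 'a) struc" where
  "sd_graph M = \<lparr> universe = universe M,
     interp = (\<lambda>r x y. case r of
        S_rel \<Rightarrow> in_str M x y \<or> in_str M y x
      | D_rel \<Rightarrow> in_str M x y \<and> in_str M y x) \<rparr>"


section \<open>Connected components and diameters\<close>

text \<open>The edge set of the graph given by the relation \<open>r\<close> of a structure.\<close>

definition edges :: "('r, 'a) struc \<Rightarrow> 'r \<Rightarrow> ('a \<times> 'a) set" where
  "edges N r = {(x, y). x \<in> universe N \<and> y \<in> universe N \<and> interp N r x y}"

text \<open>The following notions are meant for a symmetric \<open>R \<subseteq> V \<times> V\<close>. For the relation \<open>D\<close> of a
  structure elementarily equivalent to an SD-graph, symmetry is automatic, being expressed
  by a sentence.\<close>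

definition graph_components :: "'a set \<Rightarrow> ('a \<times> 'a) set \<Rightarrow> 'a set set" where
  "graph_components V R = V // R\<^sup>*"

text \<open>The distance is \<open>\<infinity>\<close> if there is no path.\<close>

definition graph_dist :: "('a \<times> 'a) set \<Rightarrow> 'a \<Rightarrow> 'a \<Rightarrow> enat" where
  "graph_dist R x y = (INF n\<in>{n. (x, y) \<in> R ^^ n}. enat n)"

definition graph_diameter :: "('a \<times> 'a) set \<Rightarrow> 'a set \<Rightarrow> enat" where
  "graph_diameter R C = (SUP x\<in>C. SUP y\<in>C. graph_dist R x y)"

end

theory Submission
  imports Defs
begin

text \<open>By downward Loewenheim-Skolem we may assume that \<open>M\<close> is countable. The points of its SD-graph whose
  \<open>D\<close>-component has finite radius form an elementary substructure, and this is \<open>N\<close>. For the Tarski-Vaught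
  criterion, a point \<open>a\<close> outside the \<open>D\<close>-ball of radius \<open>2r + 1\<close> around the parameters has to be replaced by a
  point in a component of finite radius that satisfies the same formulas of rank \<open>r\<close>. The ball \<open>B\<close> of radius \<open>r\<close>
  around \<open>a\<close> is a set, and anti-foundation yields a copy \<open>g\<close> of it with
  \<open>g u = {g v | v \<in> u \<inter> B} \<union> {x | S u x, x near the parameters} \<union> {{u, t}}\<close>. As \<open>t\<close> is fresh, the sets \<open>g u\<close> are
  distinct and do not belong to any set given before, so \<open>g\<close> preserves \<open>S\<close> and \<open>D\<close>, and all \<open>D\<close>-neighbours of
  the copy lie in the copy. The same copying step, with \<open>x\<close> moved along the isomorphism built so far, wins
  the Ehrenfeucht-Fraisse game between the two tuples.\<close>

section \<open>Elementary substructures\<close>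

instance mem :: countable by countable_datatype
instance sd :: countable by countable_datatype
instance fm :: (countable) countable by countable_datatype

lemma finite_fv: "finite (fv p)"
proof (induction p)
  case (Forall p)
  have "{n. Suc n \<in> fv p} = Suc -` fv p" by auto
  with Forall show ?case by (simp add: finite_vimageI)
qed auto

lemma sat_cong_fv: "(\<And>n. n \<in> fv p \<Longrightarrow> e n = e' n) \<Longrightarrow> sat M e p \<longleftrightarrow> sat M e' p"
proof (induction p arbitrary: e e')
  case (Neg p)
  have "sat M e p \<longleftrightarrow> sat M e' p" by (rule Neg.IH) (use Neg.prems in simp)
  then show ?case by simp
next
  case (Conj p q)
  have "sat M e p \<longleftrightarrow> sat M e' p" by (rule Conj.IH(1)) (use Conj.prems in simp)
  moreover have "sat M e q \<longleftrightarrow> sat M e' q" by (rule Conj.IH(2)) (use Conj.prems in simp)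
  ultimately show ?case by simp
next
  case (Forall p)
  have "sat M (case_nat a e) p \<longleftrightarrow> sat M (case_nat a e') p" for a
    by (rule Forall.IH) (use Forall.prems in \<open>auto split: nat.split\<close>)
  then show ?case by simp
qed simp_all

lemma range_case_nat: "range (case_nat a e) \<subseteq> A \<longleftrightarrow> a \<in> A \<and> range e \<subseteq> A"
proof -
  have "range (case_nat a e) = insert a (range e)"
    by (subst UNIV_nat_eq) (simp add: image_image)
  then show ?thesis by simp
qed

text \<open>The quantifier case rests on \<open>witness\<close> for the negated body: it moves a
  counterexample from \<open>M\<close> into \<open>V\<close>.\<close>

lemma tarski_vaught:
  assumes "V \<subseteq> universe M"
    and witness: "\<And>p e a. range e \<subseteq> V \<Longrightarrow> a \<in> universe M \<Longrightarrow> sat M (case_nat a e) p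
      \<Longrightarrow> \<exists>b\<in>V. sat M (case_nat b e) p"
    and "range e \<subseteq> V"
  shows "sat (M\<lparr>universe := V\<rparr>) e p \<longleftrightarrow> sat M e p"
  using \<open>range e \<subseteq> V\<close>
proof (induction p arbitrary: e)
  case (Forall p)
  have "sat (M\<lparr>universe := V\<rparr>) e (Forall p) \<longleftrightarrow> (\<forall>a\<in>V. sat M (case_nat a e) p)"
    using Forall by (simp add: range_case_nat)
  also have "\<dots> \<longleftrightarrow> (\<forall>a\<in>universe M. sat M (case_nat a e) p)"
    using witness[OF Forall.prems, of _ "Neg p"] assms(1) by auto
  finally show ?case by simp
qed simp_all

section \<open>Skolem hulls and the downward Loewenheim-Skolem theorem\<close>

definition env_of_list :: "'a \<Rightarrow> 'a list \<Rightarrow> nat \<Rightarrow> 'a" where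
  "env_of_list d l n = (if n < length l then l ! n else d)"

text \<open>Parameters come as finite lists, of which there are only countably many over a countable
  set. Because of the implication, a point of \<open>M\<close> is chosen even when \<open>p\<close>
  has no witness.\<close>

definition skolem :: "('r, 'a) struc \<Rightarrow> 'a \<Rightarrow> 'r fm \<Rightarrow> 'a list \<Rightarrow> 'a" where
  "skolem M d p l =
     (SOME b. b \<in> universe M \<and>
       ((\<exists>a\<in>universe M. sat M (case_nat a (env_of_list d l)) p)
          \<longrightarrow> sat M (case_nat b (env_of_list d l)) p))"

primrec skolem_hull :: "('r, 'a) struc \<Rightarrow> 'a \<Rightarrow> nat \<Rightarrow> 'a set" where
  "skolem_hull M d 0 = {d}"
| "skolem_hull M d (Suc n) =
     skolem_hull M d n \<union> (\<lambda>(p, l). skolem M d p l) ` (UNIV \<times> lists (skolem_hull M d n))"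

lemma skolem:
  assumes "d \<in> universe M"
  shows "skolem M d p l \<in> universe M \<and>
    ((\<exists>a\<in>universe M. sat M (case_nat a (env_of_list d l)) p)
      \<longrightarrow> sat M (case_nat (skolem M d p l) (env_of_list d l)) p)"
  unfolding skolem_def by (rule someI_ex) (use assms in blast)

lemma skolem_hull_subset: "d \<in> universe M \<Longrightarrow> skolem_hull M d n \<subseteq> universe M"
proof (induction n)
  case (Suc n)
  then show ?case using skolem[of d M] by (simp add: image_subset_iff)
qed simp

lemma countable_skolem_hull:
  fixes M :: "('r::countable, 'a) struc"
  shows "countable (skolem_hull M d n)"
  by (induction n) auto

lemma skolem_hull_mono: "m \<le> n \<Longrightarrow> skolem_hull M d m \<subseteq> skolem_hull M d n"
  by (rule lift_Suc_mono_le[of "skolem_hull M d"]) auto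

lemma list_in_skolem_hull:
  "l \<in> lists (\<Union>n. skolem_hull M d n) \<Longrightarrow> \<exists>n. l \<in> lists (skolem_hull M d n)"
proof (induction l)
  case (Cons x l)
  then obtain m n where "x \<in> skolem_hull M d m" "l \<in> lists (skolem_hull M d n)" by auto
  then have "x # l \<in> lists (skolem_hull M d (max m n))"
    using skolem_hull_mono[of m "max m n" M d] skolem_hull_mono[of n "max m n" M d] by auto
  then show ?case by blast
qed simp

lemma downward_loewenheim_skolem:
  fixes M :: "('r::countable, 'a) struc"
  assumes "universe M \<noteq> {}"
  obtains V where "V \<noteq> {}" "V \<subseteq> universe M" "countable V"
    "\<And>p e. range e \<subseteq> V \<Longrightarrow> sat (M\<lparr>universe := V\<rparr>) e p \<longleftrightarrow> sat M e p"
proof -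
  obtain d where d: "d \<in> universe M" using assms by blast
  define V where "V = (\<Union>n. skolem_hull M d n)"
  have dV: "d \<in> V" unfolding V_def by (rule UN_I[of 0]) auto
  have sub: "V \<subseteq> universe M" unfolding V_def using skolem_hull_subset[OF d] by blast
  have wit: "\<exists>b\<in>V. sat M (case_nat b e) p"
    if e: "range e \<subseteq> V" and a: "a \<in> universe M" "sat M (case_nat a e) p" for p e a
  proof -
    obtain k where k: "fv p \<subseteq> {..<k}"
      using finite_fv[of p] finite_nat_iff_bounded by blast
    \<comment> \<open>Only variables below \<open>k\<close> occur in \<open>p\<close>, so this
      finite part of \<open>e\<close> decides \<open>p\<close>.\<close>
    define l where "l = map e [0..<k]"
    have "set l \<subseteq> V" using e by (auto simp: l_def)
    then have "l \<in> lists (\<Union>n. skolem_hull M d n)" by (auto simp: V_def)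
    from list_in_skolem_hull[OF this] obtain n where n: "l \<in> lists (skolem_hull M d n)" ..
    have eq: "sat M (case_nat b (env_of_list d l)) p \<longleftrightarrow> sat M (case_nat b e) p" for b
      by (rule sat_cong_fv) (use k in \<open>auto simp: l_def env_of_list_def split: nat.split\<close>)
    have "sat M (case_nat (skolem M d p l) e) p"
      using skolem[OF d, of p l] a eq by metis
    moreover have "skolem M d p l \<in> skolem_hull M d (Suc n)"
      using n by (auto intro!: image_eqI[of _ _ "(p, l)"])
    ultimately show ?thesis unfolding V_def by (meson UN_I UNIV_I)
  qed
  show thesis
  proof
    show "countable V" unfolding V_def by (intro countable_UN countable_skolem_hull) simp
    show "sat (M\<lparr>universe := V\<rparr>) e p \<longleftrightarrow> sat M e p" if "range e \<subseteq> V" for p e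
      using tarski_vaught[OF sub wit that] .
    show "V \<noteq> {}" using dV by blast
  qed (rule sub)
qed

section \<open>Transfer to a model on the natural numbers and to SD-graphs\<close>

lemma sat_transport:
  assumes "h ` universe N = universe M"
    and "inj_on h (universe N)"
    and "\<And>r x y. x \<in> universe N \<Longrightarrow> y \<in> universe N \<Longrightarrow> interp N r x y \<longleftrightarrow> interp M r (h x) (h y)"
    and "range e \<subseteq> universe N"
  shows "sat N e p \<longleftrightarrow> sat M (h \<circ> e) p"
  using \<open>range e \<subseteq> universe N\<close>
proof (induction p arbitrary: e)
  case (Eq i j)
  then show ?case using assms(2) by (auto simp: inj_on_def image_subset_iff)
next
  case (Forall p)
  have "(\<lambda>n. h (case_nat a e n)) = case_nat (h a) (h \<circ> e)" for a
    by (auto split: nat.split)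
  then have "sat N e (Forall p) \<longleftrightarrow> (\<forall>a\<in>universe N. sat M (case_nat (h a) (h \<circ> e)) p)"
    using Forall by (simp add: range_case_nat comp_def)
  also have "\<dots> \<longleftrightarrow> (\<forall>b\<in>h ` universe N. sat M (case_nat b (h \<circ> e)) p)" by simp
  finally show ?case by (simp only: assms(1) sat.simps)
qed (use assms(3) in \<open>auto simp: image_subset_iff\<close>)

text \<open>The elementary submodel is renamed along an injection into the naturals, since the
  structure sought has its universe in \<open>nat\<close>; \<open>h\<close> takes the names back to
  elements of \<open>M\<close>.\<close>

lemma countable_elementary_submodel:
  fixes M :: "('r::countable, 'a) struc"
  assumes "universe M \<noteq> {}"
  obtains N :: "('r, nat) struc" and h where "universe N \<noteq> {}" "h ` universe N \<subseteq> universe M"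
    "\<And>p e. range e \<subseteq> universe N \<Longrightarrow> sat N e p \<longleftrightarrow> sat M (h \<circ> e) p"
proof -
  obtain V where V: "V \<noteq> {}" "V \<subseteq> universe M" "countable V"
    "\<And>p e. range e \<subseteq> V \<Longrightarrow> sat (M\<lparr>universe := V\<rparr>) e p \<longleftrightarrow> sat M e p"
    using downward_loewenheim_skolem[OF assms] by blast
  obtain h0 :: "_ \<Rightarrow> nat" where h0: "inj_on h0 V" using V(3) by (auto simp: countable_def)
  define h where "h = inv_into V h0"
  define N where "N = \<lparr>universe = h0 ` V, interp = (\<lambda>r x y. interp M r (h x) (h y))\<rparr>"
  have im: "h ` universe N = V" using h0 by (simp add: h_def N_def image_image)
  show thesis
  proof
    show "universe N \<noteq> {}" using V(1) by (simp add: N_def)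
    show "h ` universe N \<subseteq> universe M" using im V(2) by simp
    fix p :: "'r fm" and e :: "nat \<Rightarrow> nat" assume e: "range e \<subseteq> universe N"
    have "sat N e p \<longleftrightarrow> sat (M\<lparr>universe := V\<rparr>) (h \<circ> e) p"
    proof (rule sat_transport)
      show "inj_on h (universe N)" unfolding h_def N_def by (simp add: inj_on_inv_into)
    qed (use im e in \<open>auto simp: N_def\<close>)
    also have "\<dots> \<longleftrightarrow> sat M (h \<circ> e) p" using e im by (intro V(4)) auto
    finally show "sat N e p \<longleftrightarrow> sat M (h \<circ> e) p" .
  qed
qed

text \<open>The SD-graph is interpreted in \<open>M\<close>, and this is the translation of its
  formulas. Elementary equivalence of two models of set theory therefore passes to their
  SD-graphs.\<close>

primrec mem_fm :: "sd fm \<Rightarrow> mem fm" where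
  "mem_fm (Rel r i j) =
     (case r of S_rel \<Rightarrow> Disj (Mem i j) (Mem j i) | D_rel \<Rightarrow> Conj (Mem i j) (Mem j i))"
| "mem_fm (Eq i j) = Eq i j"
| "mem_fm (Neg p) = Neg (mem_fm p)"
| "mem_fm (Conj p q) = Conj (mem_fm p) (mem_fm q)"
| "mem_fm (Forall p) = Forall (mem_fm p)"

lemma sat_sd_graph: "sat (sd_graph M) e p \<longleftrightarrow> sat M e (mem_fm p)"
proof (induction p arbitrary: e)
  case (Rel r i j)
  then show ?case by (cases r) (simp_all add: sd_graph_def)
qed (simp_all add: sd_graph_def)

lemma true_in_sentence:
  assumes "fv p = {}" "range e \<subseteq> universe M"
  shows "true_in M p \<longleftrightarrow> sat M e p"
  unfolding true_in_def using sat_cong_fv[of p _ e M] assms by auto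

section \<open>Definable classes and sets of a model of ZFA\<close>

locale zfa_model =
  fixes M :: "(mem, 'a) struc" and c :: "nat \<Rightarrow> 'a"
  assumes range_c: "range c = universe M" and ZFA: "models M ZFA"
begin

abbreviation U :: "'a set" where "U \<equiv> universe M"

abbreviation mem (infix "\<epsilon>" 50) where "x \<epsilon> y \<equiv> in_str M x y"

lemma c_in_U [simp]: "c n \<in> U" using range_c by blast

section \<open>Classes definable with parameters\<close>

definition weave :: "(nat \<Rightarrow> 'a) \<Rightarrow> nat \<Rightarrow> 'a" where
  "weave e n = (if even n then e (n div 2) else c (n div 2))"

text \<open>Since \<open>c\<close> enumerates the universe, the odd variables of \<open>weave e\<close> provide all parameters at
  once.\<close>

definition dfn :: "((nat \<Rightarrow> 'a) \<Rightarrow> bool) \<Rightarrow> bool" where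
  "dfn P \<longleftrightarrow> (\<exists>p. \<forall>e. range e \<subseteq> U \<longrightarrow> (sat M (weave e) p \<longleftrightarrow> P e))"

text \<open>An even \<open>k\<close> names a variable of \<open>e\<close>, an odd \<open>k\<close> a
  parameter. Definability is then proved by rules that follow the logical form of \<open>P\<close>,
  without writing a formula.\<close>

definition trm :: "((nat \<Rightarrow> 'a) \<Rightarrow> 'a) \<Rightarrow> bool" where
  "trm t \<longleftrightarrow> (\<exists>k. t = (\<lambda>e. weave e k))"

lemma trm_var: "trm (\<lambda>e. e n)"
  unfolding trm_def by (rule exI[of _ "2 * n"]) (simp add: weave_def)

lemma trm_const: "a \<in> U \<Longrightarrow> trm (\<lambda>e. a)"
proof -
  assume "a \<in> U"
  then obtain n where "a = c n" using range_c by blast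
  then show ?thesis
    unfolding trm_def by (intro exI[of _ "2 * n + 1"]) (simp add: weave_def)
qed

lemma dfn_mem: "trm s \<Longrightarrow> trm t \<Longrightarrow> dfn (\<lambda>e. s e \<epsilon> t e)"
proof -
  assume "trm s" "trm t"
  then obtain k l where "s = (\<lambda>e. weave e k)" "t = (\<lambda>e. weave e l)" by (auto simp: trm_def)
  then show ?thesis unfolding dfn_def by (intro exI[of _ "Mem k l"]) simp
qed

lemma dfn_eq: "trm s \<Longrightarrow> trm t \<Longrightarrow> dfn (\<lambda>e. s e = t e)"
proof -
  assume "trm s" "trm t"
  then obtain k l where "s = (\<lambda>e. weave e k)" "t = (\<lambda>e. weave e l)" by (auto simp: trm_def)
  then show ?thesis unfolding dfn_def by (intro exI[of _ "Eq k l"]) simp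
qed

lemma dfn_not: "dfn P \<Longrightarrow> dfn (\<lambda>e. \<not> P e)"
  unfolding dfn_def by (metis sat.simps(3))

lemma dfn_conj: "dfn P \<Longrightarrow> dfn Q \<Longrightarrow> dfn (\<lambda>e. P e \<and> Q e)"
  unfolding dfn_def by (metis sat.simps(4))

lemma dfn_disj: "dfn P \<Longrightarrow> dfn Q \<Longrightarrow> dfn (\<lambda>e. P e \<or> Q e)"
  using dfn_not[OF dfn_conj[OF dfn_not[of P] dfn_not[of Q]]] by simp

lemma dfn_imp: "dfn P \<Longrightarrow> dfn Q \<Longrightarrow> dfn (\<lambda>e. P e \<longrightarrow> Q e)"
  using dfn_disj[OF dfn_not[of P], of Q] by simp

lemma dfn_iff: "dfn P \<Longrightarrow> dfn Q \<Longrightarrow> dfn (\<lambda>e. P e \<longleftrightarrow> Q e)"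
  using dfn_conj[OF dfn_imp[of P Q] dfn_imp[of Q P]] by (simp only: iff_conv_conj_imp[symmetric])

lemma dfn_False: "dfn (\<lambda>e. False)"
  using dfn_not[OF dfn_eq[OF trm_var[of 0] trm_var[of 0]]] by simp

text \<open>A quantifier shifts all variables by one, whereas a new variable of \<open>e\<close> has
  to move the even ones by two and leave the odd ones in place. The renaming corrects this.\<close>

lemma weave_case_nat:
  "(\<lambda>n. case_nat a (weave e) (if n = 0 then 0 else if even n then n - 1 else n + 1))
     = weave (case_nat a e)" (is "?L = _")
proof
  fix n
  consider "n = 0" | m where "n = 2 * Suc m" | m where "n = Suc (2 * m)"
    by (metis not0_implies_Suc oddE evenE mult_0_right Suc_eq_plus1)
  then show "?L n = weave (case_nat a e) n"
    by cases (simp_all add: weave_def)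
qed

lemma dfn_all:
  assumes "dfn (\<lambda>e. P (e 0) (\<lambda>n. e (Suc n)))"
  shows "dfn (\<lambda>e. \<forall>a\<in>U. P a e)"
proof -
  obtain p where p: "\<And>e. range e \<subseteq> U \<Longrightarrow> sat M (weave e) p \<longleftrightarrow> P (e 0) (\<lambda>n. e (Suc n))"
    using assms by (auto simp: dfn_def)
  show ?thesis unfolding dfn_def
  proof (intro exI allI impI)
    fix e :: "nat \<Rightarrow> 'a" assume e: "range e \<subseteq> U"
    let ?p = "ren (\<lambda>n. if n = 0 then 0 else if even n then n - 1 else n + 1) p"
    have "sat M (weave e) (Forall ?p) \<longleftrightarrow> (\<forall>a\<in>U. sat M (weave (case_nat a e)) p)"
      by (simp add: sat_ren weave_case_nat)
    also have "\<dots> \<longleftrightarrow> (\<forall>a\<in>U. P a e)"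
      using p[of "case_nat a e" for a] e by (simp add: range_case_nat)
    finally show "sat M (weave e) (Forall ?p) \<longleftrightarrow> (\<forall>a\<in>U. P a e)" .
  qed
qed

lemma dfn_ex:
  assumes "dfn (\<lambda>e. P (e 0) (\<lambda>n. e (Suc n)))"
  shows "dfn (\<lambda>e. \<exists>a\<in>U. P a e)"
  using dfn_not[OF dfn_all[OF dfn_not[OF assms]]] by simp

lemma dfn_cong: "dfn P \<Longrightarrow> (\<And>e. range e \<subseteq> U \<Longrightarrow> P e \<longleftrightarrow> Q e) \<Longrightarrow> dfn Q"
  unfolding dfn_def by metis

lemma dfn_subst:
  assumes "dfn P" and "\<And>i. trm (\<lambda>e. f e i)"
  shows "dfn (\<lambda>e. P (f e))"
proof -
  obtain p where p: "\<And>e. range e \<subseteq> U \<Longrightarrow> sat M (weave e) p \<longleftrightarrow> P e"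
    using assms(1) by (auto simp: dfn_def)
  obtain k where k: "\<And>i e. f e i = weave e (k i)"
    using assms(2) unfolding trm_def by metis
  show ?thesis unfolding dfn_def
  proof (intro exI allI impI)
    fix e :: "nat \<Rightarrow> 'a" assume e: "range e \<subseteq> U"
    let ?r = "\<lambda>n. if even n then k (n div 2) else n"
    have "(\<lambda>n. weave e (?r n)) = weave (f e)"
      by (auto simp: fun_eq_iff weave_def k)
    then have "sat M (weave e) (ren ?r p) \<longleftrightarrow> sat M (weave (f e)) p" by (simp add: sat_ren)
    also have "\<dots> \<longleftrightarrow> P (f e)" using e by (intro p) (auto simp: k weave_def image_subset_iff)
    finally show "sat M (weave e) (ren ?r p) \<longleftrightarrow> P (f e)" .
  qed
qed

definition dfn1 :: "('a \<Rightarrow> bool) \<Rightarrow> bool" where "dfn1 P \<longleftrightarrow> dfn (\<lambda>e. P (e 0))"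
definition dfn2 :: "('a \<Rightarrow> 'a \<Rightarrow> bool) \<Rightarrow> bool" where "dfn2 P \<longleftrightarrow> dfn (\<lambda>e. P (e 0) (e 1))"

lemma dfn1_app: "dfn1 P \<Longrightarrow> trm s \<Longrightarrow> dfn (\<lambda>e. P (s e))"
  unfolding dfn1_def by (drule dfn_subst[of _ "\<lambda>e i. s e"]) auto

lemma dfn2_app: "dfn2 P \<Longrightarrow> trm s \<Longrightarrow> trm t \<Longrightarrow> dfn (\<lambda>e. P (s e) (t e))"
proof -
  assume "dfn2 P" "trm s" "trm t"
  then have "trm (\<lambda>e. case_nat (s e) (\<lambda>_. t e) i)" for i by (cases i) auto
  with \<open>dfn2 P\<close> have "dfn (\<lambda>e. P (case_nat (s e) (\<lambda>_. t e) 0) (case_nat (s e) (\<lambda>_. t e) 1))"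
    unfolding dfn2_def by (rule dfn_subst)
  then show ?thesis by simp
qed

lemmas dfn_intros = dfn_not dfn_conj dfn_disj dfn_imp dfn_iff dfn_False dfn_all dfn_ex
  dfn_mem dfn_eq trm_var trm_const

section \<open>Sets of the model as subsets of its universe\<close>

definition ext :: "'a \<Rightarrow> 'a set" where "ext a = {x \<in> U. x \<epsilon> a}"

text \<open>This marks the external sets that are coded by an element of the model; axioms such as
  separation and replacement become closure properties of \<open>small\<close>.\<close>

definition small :: "'a set \<Rightarrow> bool" where "small A \<longleftrightarrow> (\<exists>a\<in>U. A = ext a)"

lemma sat_ZFA: "p \<in> ZFA \<Longrightarrow> range e \<subseteq> U \<Longrightarrow> sat M e p"
  using ZFA by (auto simp: models_def true_in_def)

lemma small_subset_U: "small A \<Longrightarrow> A \<subseteq> U" by (auto simp: small_def ext_def)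

lemma ext_subset_U: "ext a \<subseteq> U" by (auto simp: ext_def)

lemma small_ext: "a \<in> U \<Longrightarrow> small (ext a)" by (auto simp: small_def)

lemma ext_inject: "a \<in> U \<Longrightarrow> b \<in> U \<Longrightarrow> ext a = ext b \<Longrightarrow> a = b"
proof -
  assume "a \<in> U" "b \<in> U" "ext a = ext b"
  moreover have "sat M c ax_ext" by (rule sat_ZFA) (auto simp: ZFA_def)
  ultimately show ?thesis unfolding sat_ax_ext ext_def by blast
qed

definition mk :: "'a set \<Rightarrow> 'a" where "mk A = (THE a. a \<in> U \<and> ext a = A)"

lemma mk: assumes "small A" shows mk_in_U: "mk A \<in> U" and ext_mk: "ext (mk A) = A"
proof -
  have "\<exists>!a. a \<in> U \<and> ext a = A" using assms ext_inject unfolding small_def by blast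
  from theI'[OF this] show "mk A \<in> U" "ext (mk A) = A" by (auto simp: mk_def)
qed

lemma mem_mk: "small A \<Longrightarrow> x \<in> U \<Longrightarrow> x \<epsilon> mk A \<longleftrightarrow> x \<in> A"
  using ext_mk[of A] by (auto simp: ext_def)

lemma dfn_in_small: "small A \<Longrightarrow> dfn1 (\<lambda>x. x \<in> A)"
proof -
  assume "small A"
  then obtain a where a: "a \<in> U" "A = ext a" by (auto simp: small_def)
  have "dfn (\<lambda>e. e 0 \<epsilon> a)" by (intro dfn_intros a)
  then show ?thesis unfolding dfn1_def by (rule dfn_cong) (auto simp: a ext_def)
qed

lemma small_Collect:
  assumes "small A" "dfn1 P"
  shows "small {x \<in> A. P x}"
proof -
  obtain a where a: "a \<in> U" "A = ext a" using assms by (auto simp: small_def)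
  obtain p where p: "\<And>e. range e \<subseteq> U \<Longrightarrow> sat M (weave e) p \<longleftrightarrow> P (e 0)"
    using assms(2) by (auto simp: dfn1_def dfn_def)
  \<comment> \<open>In the environment of the instance, the tested element stands at 0,
    \<open>a\<close> at 1 and the parameters from 2 on. The even variables above 0 may get any
    value, here \<open>a\<close>.\<close>
  let ?r = "\<lambda>n. if even n then (if n = 0 then 0 else 1) else Suc (Suc (n div 2))"
  have "sat M (case_nat a c) (ax_separation (ren ?r p))"
    by (rule sat_ZFA) (auto simp: ZFA_def range_case_nat a)
  moreover have "sat M (case_nat x (case_nat a c)) (ren ?r p) \<longleftrightarrow> P x" if "x \<in> U" for x
  proof -
    have "(\<lambda>n. case_nat x (case_nat a c) (?r n)) = weave (case_nat x (\<lambda>_. a))"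
      by (auto simp: fun_eq_iff weave_def split: nat.split elim!: evenE)
    then show ?thesis using p[of "case_nat x (\<lambda>_. a)"] that a
      by (simp add: sat_ren range_case_nat)
  qed
  ultimately obtain b where "b \<in> U" "\<And>x. x \<in> U \<Longrightarrow> x \<epsilon> b \<longleftrightarrow> x \<epsilon> a \<and> P x"
    unfolding sat_ax_separation by auto
  then show ?thesis unfolding small_def a by (intro bexI[of _ b]) (auto simp: ext_def)
qed

lemma small_replacement:
  assumes "small A" "dfn2 F"
    and fn: "\<And>x y y'. x \<in> A \<Longrightarrow> y \<in> U \<Longrightarrow> y' \<in> U \<Longrightarrow> F x y \<Longrightarrow> F x y' \<Longrightarrow> y = y'"
  shows "small {y \<in> U. \<exists>x\<in>A. F x y}"
proof -
  obtain a where a: "a \<in> U" "A = ext a" using assms by (auto simp: small_def)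
  obtain p where p: "\<And>e. range e \<subseteq> U \<Longrightarrow> sat M (weave e) p \<longleftrightarrow> F (e 0) (e 1)"
    using assms(2) by (auto simp: dfn2_def dfn_def)
  \<comment> \<open>As for separation, with the argument, the value and \<open>a\<close> at 0, 1 and
    2, and the parameters from 3 on.\<close>
  let ?r = "\<lambda>n. if even n then (if n = 0 then 0 else if n = 2 then 1 else 2) else n div 2 + 3"
  have sat: "sat M (case_nat x (case_nat y (case_nat a c))) (ren ?r p) \<longleftrightarrow> F x y"
    if "x \<in> U" "y \<in> U" for x y
  proof -
    have "case_nat x (case_nat y (case_nat a c)) (?r n) = weave (case_nat x (case_nat y (\<lambda>_. a))) n" for n
    proof -
      consider "n = 0" | "n = 2" | m where "n = 2 * Suc (Suc m)" | m where "n = Suc (2 * m)"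
        by (metis not0_implies_Suc oddE evenE mult_0_right mult_1_right Suc_eq_plus1 One_nat_def)
      then show ?thesis by cases (auto simp: weave_def split: nat.split)
    qed
    then have "(\<lambda>n. case_nat x (case_nat y (case_nat a c)) (?r n)) = weave (case_nat x (case_nat y (\<lambda>_. a)))"
      by blast
    then show ?thesis using p[of "case_nat x (case_nat y (\<lambda>_. a))"] that a
      by (simp add: sat_ren range_case_nat)
  qed
  let ?p = "ren ?r p"
  have *: "sat M (case_nat a c) (ax_replacement ?p)"
    by (rule sat_ZFA) (auto simp: ZFA_def range_case_nat a)
  have "\<forall>x\<in>U. x \<epsilon> a \<longrightarrow> (\<forall>y\<in>U. \<forall>y'\<in>U.
      sat M (case_nat x (case_nat y (case_nat a c))) ?p \<and>
      sat M (case_nat x (case_nat y' (case_nat a c))) ?p \<longrightarrow> y = y')"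
    using fn sat by (simp add: a ext_def del: nat.case)
  then obtain b where b: "b \<in> U" "\<forall>y\<in>U. y \<epsilon> b \<longleftrightarrow>
      (\<exists>x\<in>U. x \<epsilon> a \<and> sat M (case_nat x (case_nat y (case_nat a c))) ?p)"
    using *[unfolded sat_ax_replacement] by (auto simp del: sat_ren)
  then have "\<forall>y\<in>U. y \<epsilon> b \<longleftrightarrow> (\<exists>x\<in>U. x \<epsilon> a \<and> F x y)"
    using sat by (simp cong: bex_cong conj_cong)
  with b(1) show ?thesis unfolding small_def a by (intro bexI[of _ b]) (auto simp: ext_def)
qed

lemma small_pair: "x \<in> U \<Longrightarrow> y \<in> U \<Longrightarrow> small {x, y}"
proof -
  assume xy: "x \<in> U" "y \<in> U"
  have "sat M c ax_pair" by (rule sat_ZFA) (auto simp: ZFA_def)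
  then obtain p where "p \<in> U" "\<forall>z\<in>U. z \<epsilon> p \<longleftrightarrow> z = x \<or> z = y"
    unfolding sat_ax_pair using xy by blast
  then show ?thesis unfolding small_def by (intro bexI[of _ p]) (auto simp: ext_def xy)
qed

lemma small_Union: "small A \<Longrightarrow> small (\<Union>x\<in>A. ext x)"
proof -
  assume "small A"
  then obtain a where a: "a \<in> U" "A = ext a" by (auto simp: small_def)
  have "sat M c ax_union" by (rule sat_ZFA) (auto simp: ZFA_def)
  then obtain b where "b \<in> U" "\<forall>z\<in>U. z \<epsilon> b \<longleftrightarrow> (\<exists>y\<in>U. y \<epsilon> a \<and> z \<epsilon> y)"
    unfolding sat_ax_union using a by blast
  then show ?thesis unfolding small_def by (intro bexI[of _ b]) (auto simp: ext_def a)
qed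

lemma small_Un: "small A \<Longrightarrow> small B \<Longrightarrow> small (A \<union> B)"
  using small_Union[OF small_pair[OF mk_in_U mk_in_U], of A B] by (simp add: ext_mk)

lemma small_empty: "small {}"
  using small_Collect[OF small_ext[OF c_in_U[of 0]], of "\<lambda>_. False"]
  by (simp add: dfn1_def dfn_False)

lemma small_insert: "x \<in> U \<Longrightarrow> small A \<Longrightarrow> small (insert x A)"
  using small_Un[OF small_pair[of x x]] by simp

text \<open>The class \<open>{z. z \<notin> z}\<close> with \<open>z \<notin> z\<close> strengthened so that the resulting set has no \<open>D\<close>-neighbours.\<close>

lemma russell:
  assumes "small W"
  obtains t where "t \<in> U" "t \<notin> W" "\<And>z. z \<in> U \<Longrightarrow> z \<epsilon> t \<Longrightarrow> t \<epsilon> z \<Longrightarrow> False"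
proof -
  define T where "T = {z \<in> W. \<not> (\<exists>w\<in>U. z \<epsilon> w \<and> w \<epsilon> z)}"
  have T: "small T" unfolding T_def using assms
    by (rule small_Collect) (unfold dfn1_def, intro dfn_intros)
  have noD: False if "z \<in> U" "z \<epsilon> mk T" "mk T \<epsilon> z" for z
  proof -
    have "z \<in> T" using that T mem_mk by blast
    then have "\<not> (\<exists>w\<in>U. z \<epsilon> w \<and> w \<epsilon> z)" by (simp add: T_def)
    then show False using that mk_in_U[OF T] by blast
  qed
  have "\<not> (mk T \<epsilon> w \<and> w \<epsilon> mk T)" if "w \<in> U" for w using noD that by blast
  \<comment> \<open>If \<open>mk T\<close> were in \<open>W\<close>, then, having no
    \<open>D\<close>-neighbour, it would belong to \<open>T\<close>, hence to itself, and so be its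
    own \<open>D\<close>-neighbour.\<close>
  then have "mk T \<notin> W"
    using mem_mk[OF T mk_in_U[OF T]] mk_in_U[OF T] unfolding T_def by blast
  then show thesis using that mk_in_U[OF T] noD by blast
qed

lemma dfn_in: "small A \<Longrightarrow> trm t \<Longrightarrow> dfn (\<lambda>e. t e \<in> A)"
  by (rule dfn1_app[OF dfn_in_small])

lemma dfn_bex:
  assumes "small B" "dfn (\<lambda>e. P (e 0) (\<lambda>n. e (Suc n)))"
  shows "dfn (\<lambda>e. \<exists>a\<in>B. P a e)"
proof -
  have "dfn (\<lambda>e. \<exists>a\<in>U. a \<in> B \<and> P a e)"
    by (rule dfn_ex, rule dfn_conj) (intro dfn_in trm_var assms)+
  then show ?thesis by (rule dfn_cong) (use small_subset_U[OF assms(1)] in blast)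
qed

lemma dfn_is_upair: "trm r \<Longrightarrow> trm s \<Longrightarrow> trm t \<Longrightarrow> dfn (\<lambda>e. is_upair M (r e) (s e) (t e))"
proof -
  assume "trm r" "trm s" "trm t"
  then obtain i j k where "r = (\<lambda>e. weave e i)" "s = (\<lambda>e. weave e j)" "t = (\<lambda>e. weave e k)"
    by (auto simp: trm_def)
  then show ?thesis unfolding dfn_def by (intro exI[of _ "fm_upair i j k"]) simp
qed

lemma dfn_is_opair: "trm r \<Longrightarrow> trm s \<Longrightarrow> trm t \<Longrightarrow> dfn (\<lambda>e. is_opair M (r e) (s e) (t e))"
proof -
  assume "trm r" "trm s" "trm t"
  then obtain i j k where "r = (\<lambda>e. weave e i)" "s = (\<lambda>e. weave e j)" "t = (\<lambda>e. weave e k)"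
    by (auto simp: trm_def)
  then show ?thesis unfolding dfn_def by (intro exI[of _ "fm_opair i j k"]) simp
qed

lemma dfn_is_app: "trm r \<Longrightarrow> trm s \<Longrightarrow> trm t \<Longrightarrow> dfn (\<lambda>e. is_app M (r e) (s e) (t e))"
proof -
  assume "trm r" "trm s" "trm t"
  then obtain i j k where "r = (\<lambda>e. weave e i)" "s = (\<lambda>e. weave e j)" "t = (\<lambda>e. weave e k)"
    by (auto simp: trm_def)
  then show ?thesis unfolding dfn_def by (intro exI[of _ "fm_app i j k"]) simp
qed

lemmas dfn_rules = dfn_intros dfn_in dfn_bex dfn_is_upair dfn_is_opair dfn_is_app

lemma is_upair_iff_ext: "a \<in> U \<Longrightarrow> b \<in> U \<Longrightarrow> is_upair M p a b \<longleftrightarrow> ext p = {a, b}"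
  unfolding is_upair_def ext_def by auto

lemma is_upair_iff: "p \<in> U \<Longrightarrow> a \<in> U \<Longrightarrow> b \<in> U \<Longrightarrow> is_upair M p a b \<longleftrightarrow> p = mk {a, b}"
  using ext_inject[of p "mk {a, b}"] ext_mk[OF small_pair[of a b]] mk_in_U[OF small_pair[of a b]]
  by (auto simp: is_upair_iff_ext)

lemma small_tagged:
  assumes B: "small B" and t: "t \<in> U"
  shows "small ((\<lambda>u. mk {u, t}) ` B)"
proof -
  have BU: "B \<subseteq> U" using B small_subset_U by blast
  have upair: "is_upair M x u t \<longleftrightarrow> x = mk {u, t}" if "x \<in> U" "u \<in> B" for x u
    using is_upair_iff that t BU by blast
  have "small {x \<in> U. \<exists>u\<in>B. is_upair M x u t}"
  proof (rule small_replacement[OF B])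
    show "dfn2 (\<lambda>u x. is_upair M x u t)" unfolding dfn2_def by (intro dfn_rules t)
  qed (simp add: upair)
  also have "{x \<in> U. \<exists>u\<in>B. is_upair M x u t} = {x \<in> U. \<exists>u\<in>B. x = mk {u, t}}"
    using upair by blast
  also have "\<dots> = (\<lambda>u. mk {u, t}) ` B"
    using mk_in_U[OF small_pair] t BU by blast
  finally show ?thesis .
qed

section \<open>Ordered pairs, functions and flat systems inside the model\<close>

definition op :: "'a \<Rightarrow> 'a \<Rightarrow> 'a" where "op a b = mk {mk {a, a}, mk {a, b}}"

lemma upair_in_U: "a \<in> U \<Longrightarrow> b \<in> U \<Longrightarrow> mk {a, b} \<in> U"
  by (intro mk_in_U small_pair)

lemma mk_upair_eq_iff:
  "a \<in> U \<Longrightarrow> b \<in> U \<Longrightarrow> x \<in> U \<Longrightarrow> y \<in> U \<Longrightarrow> mk {a, b} = mk {x, y} \<longleftrightarrow> {a, b} = {x, y}"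
  by (metis ext_mk small_pair)

lemma op_in_U: "a \<in> U \<Longrightarrow> b \<in> U \<Longrightarrow> op a b \<in> U"
  unfolding op_def by (intro upair_in_U)

lemma is_opair_iff: "p \<in> U \<Longrightarrow> a \<in> U \<Longrightarrow> b \<in> U \<Longrightarrow> is_opair M p a b \<longleftrightarrow> p = op a b"
  unfolding is_opair_def op_def using upair_in_U[of a a] by (auto simp: is_upair_iff upair_in_U)

lemma op_inject:
  assumes "a \<in> U" "b \<in> U" "x \<in> U" "y \<in> U" "op a b = op x y"
  shows "a = x \<and> b = y"
proof -
  have "{mk {a, a}, mk {a, b}} = {mk {x, x}, mk {x, y}}"
    using assms(5) assms(1-4) by (simp only: op_def mk_upair_eq_iff upair_in_U)
  then have "{a, a} = {x, x} \<and> {a, b} = {x, y} \<or> {a, a} = {x, y} \<and> {a, b} = {x, x}"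
    unfolding doubleton_eq_iff[of "mk {a, a}"] using assms(1-4) by (simp only: mk_upair_eq_iff)
  then show ?thesis by (auto simp: doubleton_eq_iff)
qed

text \<open>Anti-foundation speaks of systems that are elements of the model; replacement turns a
  definable function on a set into such an element.\<close>

lemma internal_function:
  assumes X: "X \<in> U" and F: "dfn2 F" and total: "\<And>x. x \<in> ext X \<Longrightarrow> \<exists>!y. y \<in> U \<and> F x y"
  obtains s where "s \<in> U" "is_function M s X"
    "\<And>x y. x \<in> U \<Longrightarrow> y \<in> U \<Longrightarrow> is_app M s x y \<longleftrightarrow> x \<in> ext X \<and> F x y"
proof -
  define S where "S = {p \<in> U. \<exists>x\<in>ext X. \<exists>y\<in>U. F x y \<and> is_opair M p x y}"
  have S: "small S" unfolding S_def
  proof (rule small_replacement)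
    show "small (ext X)" using X by (rule small_ext)
    show "dfn2 (\<lambda>x p. \<exists>y\<in>U. F x y \<and> is_opair M p x y)"
      unfolding dfn2_def by (intro dfn_rules dfn2_app[OF F])
    fix x p p' assume a: "x \<in> ext X" "p \<in> U" "p' \<in> U" "\<exists>y\<in>U. F x y \<and> is_opair M p x y"
      "\<exists>y\<in>U. F x y \<and> is_opair M p' x y"
    then have "x \<in> U" using ext_subset_U by blast
    with a show "p = p'" using total[OF a(1)] by (metis is_opair_iff)
  qed
  have app: "is_app M (mk S) x y \<longleftrightarrow> x \<in> ext X \<and> F x y" if "x \<in> U" "y \<in> U" for x y
  proof
    assume "is_app M (mk S) x y"
    then obtain p where p: "p \<in> U" "p \<in> S" "is_opair M p x y"
      using mem_mk[OF S] by (auto simp: is_app_def)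
    then obtain x' y' where q: "x' \<in> ext X" "y' \<in> U" "F x' y'" "is_opair M p x' y'"
      by (auto simp: S_def)
    then have "x' \<in> U" using ext_subset_U by blast
    then have "x = x' \<and> y = y'" using p q that by (intro op_inject) (auto simp: is_opair_iff)
    then show "x \<in> ext X \<and> F x y" using q by simp
  next
    assume a: "x \<in> ext X \<and> F x y"
    then have "op x y \<in> S" using that op_in_U is_opair_iff unfolding S_def by blast
    then show "is_app M (mk S) x y" unfolding is_app_def
      using that op_in_U mem_mk[OF S] is_opair_iff by blast
  qed
  show thesis
  proof
    show "mk S \<in> U" by (rule mk_in_U[OF S])
    show "is_function M (mk S) X" unfolding is_function_def
    proof (intro conjI ballI impI)
      fix p assume "p \<in> U" "p \<epsilon> mk S"
      then have "p \<in> S" using mem_mk[OF S] by blast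
      then show "\<exists>x\<in>U. x \<epsilon> X \<and> (\<exists>y\<in>U. is_opair M p x y)" by (auto simp: S_def ext_def)
    next
      fix x assume "x \<in> U" "x \<epsilon> X"
      then have "x \<in> ext X" by (simp add: ext_def)
      with total show "\<exists>!y. y \<in> U \<and> is_app M (mk S) x y" using app \<open>x \<in> U\<close> by (metis (no_types))
    qed
  qed (rule app)
qed

text \<open>The right-hand side of \<open>x\<close> is \<open>{z \<in> X \<union> A. E x z}\<close>,
  a set by separation, so a definable relation \<open>E\<close> is enough to describe the system. In
  the proof, \<open>F x t\<close> says that \<open>t\<close> is this set.\<close>

lemma flat_system_solution:
  assumes X: "small X" and A: "small A" and disj: "X \<inter> A = {}" and E: "dfn2 E"
  obtains f where "f \<in> U" "\<And>x. x \<in> X \<Longrightarrow> \<exists>!y. y \<in> U \<and> is_app M f x y"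
    "\<And>x w z. x \<in> X \<Longrightarrow> w \<in> U \<Longrightarrow> is_app M f x w \<Longrightarrow> z \<in> U \<Longrightarrow>
      z \<epsilon> w \<longleftrightarrow> (\<exists>y\<in>X. E x y \<and> is_app M f y z) \<or> z \<in> A \<and> E x z"
proof -
  define F where "F x t \<longleftrightarrow> (\<forall>z\<in>U. z \<epsilon> t \<longleftrightarrow> (z \<in> X \<or> z \<in> A) \<and> E x z)" for x t
  have XU: "X \<subseteq> U" and AU: "A \<subseteq> U" using X A small_subset_U by auto
  have dF: "dfn2 F" unfolding F_def dfn2_def by (intro dfn_rules X A dfn2_app[OF E])
  have total: "\<exists>!t. t \<in> U \<and> F x t" if "x \<in> U" for x
  proof -
    have sm: "small {z \<in> X \<union> A. E x z}"
      by (rule small_Collect[OF small_Un[OF X A]]) (unfold dfn1_def, intro dfn2_app[OF E] trm_var trm_const that)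
    show ?thesis
    proof (rule ex1I[of _ "mk {z \<in> X \<union> A. E x z}"])
      show "mk {z \<in> X \<union> A. E x z} \<in> U \<and> F x (mk {z \<in> X \<union> A. E x z})"
        using mk_in_U[OF sm] mem_mk[OF sm] by (auto simp: F_def)
      fix t assume t: "t \<in> U \<and> F x t"
      then have "ext t = {z \<in> X \<union> A. E x z}" using XU AU by (auto simp: F_def ext_def)
      then show "t = mk {z \<in> X \<union> A. E x z}" using t ext_inject mk[OF sm] by metis
    qed
  qed
  have eX: "x \<epsilon> mk X \<longleftrightarrow> x \<in> X" and eA: "x \<epsilon> mk A \<longleftrightarrow> x \<in> A" if "x \<in> U" for x
    using mem_mk X A that by auto
  have "\<exists>!y. y \<in> U \<and> F x y" if "x \<in> ext (mk X)" for x
    using total that by (auto simp: ext_def)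
  from internal_function[OF mk_in_U[OF X] dF this]
  obtain s where s: "s \<in> U" "is_function M s (mk X)"
    "\<And>x y. x \<in> U \<Longrightarrow> y \<in> U \<Longrightarrow> is_app M s x y \<longleftrightarrow> x \<in> ext (mk X) \<and> F x y" by blast
  have "is_flat_system M (mk X) (mk A) s"
    unfolding is_flat_system_def using s disj eX eA by (auto simp: F_def ext_mk[OF X])
  moreover have "sat M c ax_afa" by (rule sat_ZFA) (auto simp: ZFA_def)
  ultimately obtain f where f: "f \<in> U" "is_solution M (mk X) (mk A) s f"
    unfolding sat_ax_afa using s mk_in_U[OF X] mk_in_U[OF A] by blast
  show thesis
  proof (rule that[OF f(1)])
    fix x assume x: "x \<in> X"
    then have xU: "x \<in> U" using XU by blast
    show "\<exists>!y. y \<in> U \<and> is_app M f x y"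
      using f(2) eX[OF xU] x xU unfolding is_solution_def is_function_def by blast
    fix w z assume w: "w \<in> U" "is_app M f x w" "z \<in> U"
    obtain t where t: "t \<in> U" "F x t" using total[OF xU] by blast
    then have "is_app M s x t" using s(3) x xU ext_mk[OF X] by blast
    then have "z \<epsilon> w \<longleftrightarrow> (\<exists>y\<in>U. y \<epsilon> t \<and> y \<epsilon> mk X \<and> is_app M f y z) \<or> z \<epsilon> t \<and> z \<epsilon> mk A"
      using f(2) eX[OF xU] x xU w t(1) unfolding is_solution_def by blast
    also have "\<dots> \<longleftrightarrow> (\<exists>y\<in>X. E x y \<and> is_app M f y z) \<or> z \<in> A \<and> E x z"
      using t(2) XU AU eX eA w unfolding F_def by blast
    finally show "z \<epsilon> w \<longleftrightarrow> (\<exists>y\<in>X. E x y \<and> is_app M f y z) \<or> z \<in> A \<and> E x z" .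
  qed
qed

text \<open>Tagging the elements \<open>u\<close> of \<open>B\<close> as \<open>{u, t}\<close> with a fresh \<open>t\<close> makes the indeterminates disjoint
  from \<open>A\<close>.\<close>

lemma anti_foundation:
  assumes B: "small B" and A: "small A" and E: "dfn2 E" and F: "dfn2 F"
  obtains g where "\<And>u. u \<in> B \<Longrightarrow> g u \<in> U"
    "\<And>u z. u \<in> B \<Longrightarrow> z \<in> U \<Longrightarrow> z \<epsilon> g u \<longleftrightarrow> (\<exists>v\<in>B. E u v \<and> z = g v) \<or> z \<in> A \<and> F u z"
    "dfn2 (\<lambda>u y. u \<in> B \<and> y = g u)"
proof -
  \<comment> \<open>No element of \<open>A\<close> has \<open>t\<close> as an element, whereas every
    tag does; so no tag lies in \<open>A\<close>.\<close>
  obtain t where t: "t \<in> U" "t \<notin> (\<Union>x\<in>A. ext x)"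
    using russell[OF small_Union[OF A]] by blast
  have BU: "B \<subseteq> U" using B small_subset_U by blast
  define tag where "tag u = mk {u, t}" for u
  have tagU: "tag u \<in> U" if "u \<in> U" for u using that t upair_in_U by (simp add: tag_def)
  have tag_inj: "tag u = tag v \<longleftrightarrow> u = v" if "u \<in> U" "v \<in> U" for u v
    using that t by (auto simp: tag_def mk_upair_eq_iff doubleton_eq_iff)
  have upair: "is_upair M x u t \<longleftrightarrow> x = tag u" if "x \<in> U" "u \<in> U" for x u
    using that t by (simp add: is_upair_iff tag_def)
  define X where "X = tag ` B"
  have X: "small X" unfolding X_def tag_def using B t(1) by (rule small_tagged)
  have "tag u \<notin> A" if "u \<in> B" for u
  proof
    assume "tag u \<in> A"
    moreover have "t \<in> ext (tag u)" using that BU t ext_mk[OF small_pair, of u t] by (auto simp: tag_def)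
    ultimately show False using t by blast
  qed
  then have disj: "X \<inter> A = {}" by (auto simp: X_def)
  \<comment> \<open>\<open>G\<close> carries the system over to the tags: \<open>E\<close> acts
    between tags, \<open>F\<close> from a tag to a member of \<open>A\<close>.\<close>
  define G where "G x z \<longleftrightarrow> (\<exists>u\<in>B. is_upair M x u t \<and>
     ((\<exists>v\<in>B. E u v \<and> is_upair M z v t) \<or> z \<in> A \<and> F u z))" for x z
  have "dfn2 G" unfolding G_def dfn2_def
    by (intro dfn_rules A B t dfn2_app[OF E] dfn2_app[OF F])
  from flat_system_solution[OF X A disj this] obtain f where f: "f \<in> U"
    "\<And>x. x \<in> X \<Longrightarrow> \<exists>!y. y \<in> U \<and> is_app M f x y"
    "\<And>x w z. x \<in> X \<Longrightarrow> w \<in> U \<Longrightarrow> is_app M f x w \<Longrightarrow> z \<in> U \<Longrightarrow>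
      z \<epsilon> w \<longleftrightarrow> (\<exists>y\<in>X. G x y \<and> is_app M f y z) \<or> z \<in> A \<and> G x z" by blast
  define g where "g u = (THE y. y \<in> U \<and> is_app M f (tag u) y)" for u
  have g: "g u \<in> U \<and> is_app M f (tag u) (g u)" if "u \<in> B" for u
    unfolding g_def by (rule theI') (use f(2) that in \<open>auto simp: X_def\<close>)
  have g_eq: "is_app M f (tag u) y \<longleftrightarrow> y = g u" if "u \<in> B" "y \<in> U" for u y
    using f(2)[of "tag u"] g[OF that(1)] that by (auto simp: X_def)
  show thesis
  proof
    show "g u \<in> U" if "u \<in> B" for u using g that by blast
    \<comment> \<open>The solution \<open>f\<close> is an element of the model, so it may serve as a
      parameter in a definition of \<open>g\<close>.\<close>
    have "dfn2 (\<lambda>u y. u \<in> B \<and> (\<exists>x\<in>U. is_upair M x u t \<and> is_app M f x y))"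
      unfolding dfn2_def by (intro dfn_rules B t f)
    then show "dfn2 (\<lambda>u y. u \<in> B \<and> y = g u)"
      unfolding dfn2_def
    proof (rule dfn_cong)
      fix e :: "nat \<Rightarrow> 'a" assume e: "range e \<subseteq> U"
      then have "e 0 \<in> U" "e 1 \<in> U" by auto
      then show "(e 0 \<in> B \<and> (\<exists>x\<in>U. is_upair M x (e 0) t \<and> is_app M f x (e 1))) \<longleftrightarrow>
          e 0 \<in> B \<and> e 1 = g (e 0)"
        using upair tagU g_eq by blast
    qed
  next
    fix u z assume uz: "u \<in> B" "z \<in> U"
    have uU: "u \<in> U" using uz BU by blast
    have G1: "G (tag u) y \<longleftrightarrow> (\<exists>v\<in>B. E u v \<and> y = tag v) \<or> y \<in> A \<and> F u y" if "y \<in> U" for y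
    proof -
      have "G (tag u) y \<longleftrightarrow> (\<exists>v\<in>B. E u v \<and> is_upair M y v t) \<or> y \<in> A \<and> F u y"
        unfolding G_def using upair[OF tagU[OF uU]] tag_inj[OF uU] BU uz(1) by blast
      then show ?thesis using upair[OF that] BU by blast
    qed
    have "z \<epsilon> g u \<longleftrightarrow> (\<exists>y\<in>X. G (tag u) y \<and> is_app M f y z) \<or> z \<in> A \<and> G (tag u) z"
      using f(3)[of "tag u" "g u" z] g uz by (simp add: X_def)
    also have "(\<exists>y\<in>X. G (tag u) y \<and> is_app M f y z) \<longleftrightarrow> (\<exists>v\<in>B. E u v \<and> z = g v)"
    proof
      assume "\<exists>y\<in>X. G (tag u) y \<and> is_app M f y z"
      then obtain y where y: "y \<in> X" "G (tag u) y" "is_app M f y z" by blast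
      then have "y \<in> U" "y \<notin> A" using X small_subset_U disj by auto
      then obtain v where "v \<in> B" "E u v" "y = tag v" using G1 y by blast
      then show "\<exists>v\<in>B. E u v \<and> z = g v" using y g_eq uz by blast
    next
      assume "\<exists>v\<in>B. E u v \<and> z = g v"
      then obtain v where v: "v \<in> B" "E u v" "z = g v" by blast
      then have "G (tag u) (tag v)" using G1[of "tag v"] tagU BU by blast
      then show "\<exists>y\<in>X. G (tag u) y \<and> is_app M f y z" using v g by (auto simp: X_def)
    qed
    also have "z \<in> A \<and> G (tag u) z \<longleftrightarrow> z \<in> A \<and> F u z"
    proof -
      have "z \<notin> X" if "z \<in> A" using disj that by blast
      then show ?thesis using G1[OF uz(2)] by (auto simp: X_def)
    qed
    finally show "z \<epsilon> g u \<longleftrightarrow> (\<exists>v\<in>B. E u v \<and> z = g v) \<or> z \<in> A \<and> F u z" .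
  qed
qed

end

section \<open>A back-and-forth system on the SD-graph\<close>

context zfa_model begin

section \<open>The relations of the SD-graph and the balls for \<open>D\<close>\<close>

abbreviation Sr :: "'a \<Rightarrow> 'a \<Rightarrow> bool" where "Sr x y \<equiv> x \<epsilon> y \<or> y \<epsilon> x"
abbreviation Dr :: "'a \<Rightarrow> 'a \<Rightarrow> bool" where "Dr x y \<equiv> x \<epsilon> y \<and> y \<epsilon> x"

primrec ball :: "'a set \<Rightarrow> nat \<Rightarrow> 'a set" where
  "ball A 0 = A"
| "ball A (Suc n) = ball A n \<union> {y \<in> U. \<exists>x\<in>ball A n. Dr x y}"

text \<open>A \<open>D\<close>-neighbour of \<open>x\<close> is an element of \<open>x\<close>, so
  the next ball is separated from the union of the ball with the elements of its points.\<close>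

lemma small_ball: "small A \<Longrightarrow> small (ball A n)"
proof (induction n)
  case (Suc n)
  then have B: "small (ball A n)" by simp
  let ?W = "ball A n \<union> (\<Union>x\<in>ball A n. ext x)"
  have "small {y \<in> ?W. y \<in> ball A n \<or> (\<exists>x\<in>ball A n. Dr x y)}"
    by (rule small_Collect) (intro small_Un small_Union B, unfold dfn1_def, intro dfn_rules B)
  also have "{y \<in> ?W. y \<in> ball A n \<or> (\<exists>x\<in>ball A n. Dr x y)} = ball A (Suc n)"
    using small_subset_U[OF B] by (auto simp: ext_def)
  finally show ?case .
qed simp

lemma ball_mono: "i \<le> j \<Longrightarrow> ball A i \<subseteq> ball A j"
  by (rule lift_Suc_mono_le[of "ball A"]) auto

lemma small_image:
  assumes "small A" "dfn2 (\<lambda>x y. x \<in> B \<and> y = g x)" "A \<subseteq> B" "g ` A \<subseteq> U"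
  shows "small (g ` A)"
proof -
  have "small {y \<in> U. \<exists>x\<in>A. x \<in> B \<and> y = g x}"
    by (rule small_replacement[OF assms(1,2)]) simp
  also have "{y \<in> U. \<exists>x\<in>A. x \<in> B \<and> y = g x} = g ` A" using assms(3,4) by blast
  finally show ?thesis .
qed

text \<open>\<open>h\<close> is an \<open>{S, D}\<close>-isomorphism between the last terms of two chains in which every \<open>D\<close>-neighbour of
  an element of a term lies in the next term; its definability is what allows it to be used in an instance of
  anti-foundation.\<close>

definition match :: "nat \<Rightarrow> (nat \<Rightarrow> 'a set) \<Rightarrow> (nat \<Rightarrow> 'a set) \<Rightarrow> ('a \<Rightarrow> 'a) \<Rightarrow> bool" where
  "match r P Q h \<longleftrightarrow>
     (\<forall>i\<le>r. small (P i) \<and> small (Q i) \<and> h ` P i = Q i) \<and>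
     (\<forall>i<r. P i \<subseteq> P (Suc i)) \<and>
     (\<forall>i<r. \<forall>x\<in>P i. \<forall>y\<in>U. Dr x y \<longrightarrow> y \<in> P (Suc i)) \<and>
     (\<forall>i<r. \<forall>x\<in>Q i. \<forall>y\<in>U. Dr x y \<longrightarrow> y \<in> Q (Suc i)) \<and>
     inj_on h (P r) \<and>
     (\<forall>x\<in>P r. \<forall>y\<in>P r. (Sr x y \<longleftrightarrow> Sr (h x) (h y)) \<and> (Dr x y \<longleftrightarrow> Dr (h x) (h y))) \<and>
     dfn2 (\<lambda>x y. x \<in> P r \<and> y = h x)"

section \<open>Symmetry and restriction of matches\<close>

lemma matchD:
  assumes "match r P Q h"
  shows "\<And>i. i \<le> r \<Longrightarrow> small (P i)" "\<And>i. i \<le> r \<Longrightarrow> small (Q i)" "\<And>i. i \<le> r \<Longrightarrow> h ` P i = Q i"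
    "\<And>i. i < r \<Longrightarrow> P i \<subseteq> P (Suc i)"
    "\<And>i x y. i < r \<Longrightarrow> x \<in> P i \<Longrightarrow> y \<in> U \<Longrightarrow> Dr x y \<Longrightarrow> y \<in> P (Suc i)"
    "\<And>i x y. i < r \<Longrightarrow> x \<in> Q i \<Longrightarrow> y \<in> U \<Longrightarrow> Dr x y \<Longrightarrow> y \<in> Q (Suc i)"
    "inj_on h (P r)"
    "\<And>x y. x \<in> P r \<Longrightarrow> y \<in> P r \<Longrightarrow> Sr x y \<longleftrightarrow> Sr (h x) (h y)"
    "\<And>x y. x \<in> P r \<Longrightarrow> y \<in> P r \<Longrightarrow> Dr x y \<longleftrightarrow> Dr (h x) (h y)"
    "dfn2 (\<lambda>x y. x \<in> P r \<and> y = h x)"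
  using assms unfolding match_def by simp_all

lemma matchI:
  assumes "\<And>i. i \<le> r \<Longrightarrow> small (P i)" "\<And>i. i \<le> r \<Longrightarrow> small (Q i)" "\<And>i. i \<le> r \<Longrightarrow> h ` P i = Q i"
    "\<And>i. i < r \<Longrightarrow> P i \<subseteq> P (Suc i)"
    "\<And>i x y. i < r \<Longrightarrow> x \<in> P i \<Longrightarrow> y \<in> U \<Longrightarrow> Dr x y \<Longrightarrow> y \<in> P (Suc i)"
    "\<And>i x y. i < r \<Longrightarrow> x \<in> Q i \<Longrightarrow> y \<in> U \<Longrightarrow> Dr x y \<Longrightarrow> y \<in> Q (Suc i)"
    "inj_on h (P r)"
    "\<And>x y. x \<in> P r \<Longrightarrow> y \<in> P r \<Longrightarrow> Sr x y \<longleftrightarrow> Sr (h x) (h y)"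
    "\<And>x y. x \<in> P r \<Longrightarrow> y \<in> P r \<Longrightarrow> Dr x y \<longleftrightarrow> Dr (h x) (h y)"
    "dfn2 (\<lambda>x y. x \<in> P r \<and> y = h x)"
  shows "match r P Q h"
  unfolding match_def by (intro conjI allI impI ballI; (fact assms | rule assms; assumption))

lemma match_mono: "match r P Q h \<Longrightarrow> i \<le> j \<Longrightarrow> j \<le> r \<Longrightarrow> P i \<subseteq> P j"
proof (induction j)
  case (Suc j)
  then show ?case using matchD(4)[OF Suc.prems(1), of j] by (cases "i = Suc j") auto
qed auto

text \<open>This gives the back half of the game. The inverse of \<open>h\<close> is definable
  because its graph is that of \<open>h\<close> with the variables exchanged.\<close>

lemma match_sym:
  assumes m: "match r P Q h"
  shows "match r Q P (inv_into (P r) h)"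
proof (rule matchI)
  have inj: "inj_on h (P r)" by (rule matchD(7)[OF m])
  show inv: "inv_into (P r) h ` Q i = P i" if "i \<le> r" for i
    using inv_into_image_cancel[OF inj match_mono[OF m that order_refl]] matchD(3)[OF m that] by simp
  have hinv: "h (inv_into (P r) h y) = y" if "y \<in> Q r" for y
    using that matchD(3)[OF m order_refl] f_inv_into_f by metis
  have invP: "inv_into (P r) h y \<in> P r" if "y \<in> Q r" for y
    using that inv[OF order_refl] by (metis image_eqI)
  show "Sr x y \<longleftrightarrow> Sr (inv_into (P r) h x) (inv_into (P r) h y)" if "x \<in> Q r" "y \<in> Q r" for x y
    using matchD(8)[OF m invP[OF that(1)] invP[OF that(2)]] that by (simp add: hinv)
  show "Dr x y \<longleftrightarrow> Dr (inv_into (P r) h x) (inv_into (P r) h y)" if "x \<in> Q r" "y \<in> Q r" for x y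
    using matchD(9)[OF m invP[OF that(1)] invP[OF that(2)]] that by (simp add: hinv)
  show "Q i \<subseteq> Q (Suc i)" if "i < r" for i
  proof -
    have "h ` P i \<subseteq> h ` P (Suc i)" by (rule image_mono[OF matchD(4)[OF m that]])
    then show ?thesis using matchD(3)[OF m] that by simp
  qed
  have "dfn2 (\<lambda>y x. x \<in> P r \<and> y = h x)"
    unfolding dfn2_def using dfn2_app[OF matchD(10)[OF m] trm_var[of 1] trm_var[of 0]] .
  moreover have "(x \<in> P r \<and> y = h x) \<longleftrightarrow> (y \<in> Q r \<and> x = inv_into (P r) h y)" for x y
    using hinv invP inv_into_f_f[OF inj] matchD(3)[OF m order_refl] by (metis image_eqI)
  ultimately show "dfn2 (\<lambda>y x. y \<in> Q r \<and> x = inv_into (P r) h y)" by simp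
  show "inj_on (inv_into (P r) h) (Q r)"
    by (rule inj_on_inv_into) (simp add: matchD(3)[OF m])
qed (use matchD(1,2,5,6)[OF m] in auto)

text \<open>For a new point in \<open>P j\<close> the chains are restarted at index
  \<open>j\<close>, which costs \<open>j\<close> terms.\<close>

lemma match_near:
  assumes m: "match r P Q h" and jr: "j + r' \<le> r"
  shows "match r' (\<lambda>i. P (j + i)) (\<lambda>i. Q (j + i)) h"
proof (rule matchI)
  have sub: "P (j + r') \<subseteq> P r" using match_mono[OF m jr] by simp
  have sm: "small (P (j + r'))" using matchD(1)[OF m jr] .
  have "dfn2 (\<lambda>x y. x \<in> P (j + r') \<and> x \<in> P r \<and> y = h x)"
    unfolding dfn2_def by (intro dfn_conj[OF dfn_in[OF sm trm_var]] dfn2_app[OF matchD(10)[OF m]] trm_var)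
  moreover have "(x \<in> P (j + r') \<and> x \<in> P r \<and> y = h x) \<longleftrightarrow> (x \<in> P (j + r') \<and> y = h x)" for x y
    using sub by blast
  ultimately show "dfn2 (\<lambda>x y. x \<in> P (j + r') \<and> y = h x)" by simp
  show "inj_on h (P (j + r'))" using matchD(7)[OF m] sub by (rule inj_on_subset)
  show "Sr x y \<longleftrightarrow> Sr (h x) (h y)" if "x \<in> P (j + r')" "y \<in> P (j + r')" for x y
    by (rule matchD(8)[OF m]) (use sub that in auto)
  show "Dr x y \<longleftrightarrow> Dr (h x) (h y)" if "x \<in> P (j + r')" "y \<in> P (j + r')" for x y
    by (rule matchD(9)[OF m]) (use sub that in auto)
qed (use matchD(1-6)[OF m] jr in simp_all)

text \<open>A ball without \<open>D\<close>-neighbours outside it is a whole component, so this says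
  that the component of \<open>x\<close> has finite radius. The number \<open>n\<close> is a
  standard one, even if the model has nonstandard numbers.\<close>

definition bounded_comp :: "'a \<Rightarrow> bool" where
  "bounded_comp x \<longleftrightarrow> (\<exists>z\<in>U. \<exists>n. x \<in> ball {z} n \<and> ball {z} (Suc n) \<subseteq> ball {z} n)"

text \<open>A path of \<open>i\<close> steps from a point of \<open>P j\<close> to \<open>a\<close>
  would put \<open>a\<close> into \<open>P (i + j)\<close>, hence into \<open>P n\<close>. The
  induction takes each step from the ball and gives it to the chain.\<close>

lemma match_disjoint_ball:
  assumes m: "match r P Q h" and "n \<le> r" "a \<in> U" "a \<notin> P n" "i + j \<le> n"
  shows "ball {a} i \<inter> P j = {}"
  using \<open>i + j \<le> n\<close>
proof (induction i arbitrary: j)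
  case 0
  then show ?case using match_mono[OF m, of j n] assms by auto
next
  case (Suc i)
  have "ball {a} i \<inter> P j = {}" using Suc by simp
  moreover have False if "x \<in> ball {a} i" "y \<in> P j" "y \<in> U" "Dr x y" for x y
  proof -
    have "x \<in> U" using that small_subset_U[OF small_ball[of "{a}" i]] small_pair[of a a] assms by auto
    then have "x \<in> P (Suc j)" using matchD(5)[OF m, of j y x] that Suc.prems assms(2) by simp
    then show False using Suc.IH[of "Suc j"] Suc.prems that by auto
  qed
  ultimately show ?case by auto
qed

text \<open>Anti-foundation is applied to \<open>g u = {g v | v \<in> u \<inter> B} \<union> {y
  \<in> A | R u y} \<union> {lab u}\<close> with \<open>lab u = {u, t}\<close>. The labels separate
  the points of the copy, and \<open>t\<close> keeps them apart from old sets. As members of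
  \<open>A\<close> are put into \<open>g u\<close> but never the reverse, \<open>R\<close> creates
  no \<open>D\<close>-edge.\<close>

lemma fresh_copy:
  assumes B: "small B" and A: "small A" and R: "dfn2 R"
  obtains g where "\<And>u. u \<in> B \<Longrightarrow> g u \<in> U" "dfn2 (\<lambda>u y. u \<in> B \<and> y = g u)" "inj_on g B"
    "\<And>u y. u \<in> B \<Longrightarrow> y \<in> A \<Longrightarrow> y \<noteq> g u"
    "\<And>u y. u \<in> B \<Longrightarrow> y \<in> A \<Longrightarrow> \<not> g u \<epsilon> y"
    "\<And>u y. u \<in> B \<Longrightarrow> y \<in> A \<Longrightarrow> y \<epsilon> g u \<longleftrightarrow> R u y"
    "\<And>u v. u \<in> B \<Longrightarrow> v \<in> B \<Longrightarrow> g u \<epsilon> g v \<longleftrightarrow> u \<epsilon> v"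
    "\<And>u y. u \<in> B \<Longrightarrow> y \<in> U \<Longrightarrow> Dr (g u) y \<Longrightarrow> y \<in> g ` B"
proof -
  \<comment> \<open>\<open>B\<close> is added because \<open>u\<close> is an element of its label;
    so \<open>u\<close> too must differ from all copies and labels.\<close>
  define A0 where "A0 = A \<union> B"
  have A0: "small A0" unfolding A0_def by (intro small_Un A B)
  let ?up = "\<lambda>A. \<Union>x\<in>A. ext x"
  have A1: "small (?up A0)" and A2: "small (?up (?up A0))" and A3: "small (?up (?up (?up A0)))"
    by (intro small_Union A0)+
  \<comment> \<open>Since \<open>t \<in> lab u \<in> g u\<close>, a copy in \<open>A0\<close> would
    put \<open>t\<close> into the second union, and a copy inside a member of \<open>A0\<close>
    would put it into the third. Having no \<open>D\<close>-neighbours keeps \<open>t\<close> itself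
    from being a copy or a label.\<close>
  obtain t where t: "t \<in> U" and tW: "t \<notin> A0 \<union> ?up A0 \<union> ?up (?up A0) \<union> ?up (?up (?up A0))"
    and russ: "\<And>z. z \<in> U \<Longrightarrow> z \<epsilon> t \<Longrightarrow> t \<epsilon> z \<Longrightarrow> False"
    using russell[OF small_Un[OF small_Un[OF small_Un[OF A0 A1] A2] A3]] by metis
  have BU: "B \<subseteq> U" and AU: "A \<subseteq> U"
    using A B small_subset_U by auto
  have up: "x \<in> ?up S" if "x \<in> U" "x \<epsilon> y" "y \<in> S" for x y S
    using that by (auto simp: ext_def)
  define lab where "lab u = mk {u, t}" for u
  have labU: "lab u \<in> U" if "u \<in> B" for u
    unfolding lab_def using that BU t upair_in_U by blast
  have ext_lab: "y \<epsilon> lab u \<longleftrightarrow> y = u \<or> y = t" if "u \<in> B" "y \<in> U" for u y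
    unfolding lab_def using mem_mk[OF small_pair] that BU t by blast
  have u_ne_t: "u \<noteq> t" if "u \<in> B" for u using that tW by (auto simp: A0_def)
  have lab_inj: "u = v" if "u \<in> B" "v \<in> B" "lab u = lab v" for u v
    by (metis that ext_lab u_ne_t BU subsetD)
  define L where "L = lab ` B"
  have L: "small L" unfolding L_def lab_def by (rule small_tagged[OF B t])
  have d2: "dfn2 (\<lambda>u z. z \<in> A \<and> R u z \<or> is_upair M z u t)"
    unfolding dfn2_def by (intro dfn_rules A t dfn2_app[OF R])
  have d1: "dfn2 (\<lambda>u v. v \<epsilon> u)" unfolding dfn2_def by (intro dfn_rules)
  show thesis
  proof (rule anti_foundation[OF B small_Un[OF A L] d1 d2])
    fix g assume g: "\<And>u. u \<in> B \<Longrightarrow> g u \<in> U"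
      "\<And>u z. u \<in> B \<Longrightarrow> z \<in> U \<Longrightarrow> z \<epsilon> g u \<longleftrightarrow>
        (\<exists>v\<in>B. v \<epsilon> u \<and> z = g v) \<or> z \<in> A \<union> L \<and> (z \<in> A \<and> R u z \<or> is_upair M z u t)"
      "dfn2 (\<lambda>u y. u \<in> B \<and> y = g u)"
    have mem_g: "z \<epsilon> g u \<longleftrightarrow> (\<exists>v\<in>B. v \<epsilon> u \<and> z = g v) \<or> z \<in> A \<and> R u z \<or> z = lab u"
      if "u \<in> B" "z \<in> U" for u z
    proof -
      have "is_upair M z u t \<longleftrightarrow> z = lab u"
        unfolding lab_def using is_upair_iff that BU t by blast
      then show ?thesis using g(2)[OF that] that(1) by (auto simp: L_def)
    qed
    have lab_g: "lab u \<epsilon> g u" if "u \<in> B" for u using mem_g[OF that labU[OF that]] by blast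
    have t_lab: "t \<epsilon> lab u" if "u \<in> B" for u using ext_lab[OF that t] by blast
    have ne: "y \<noteq> g u" if "u \<in> B" "y \<in> A0" for u y
    proof
      assume "y = g u"
      then have "lab u \<in> ?up A0" using up[OF labU[OF that(1)]] lab_g that by metis
      then have "t \<in> ?up (?up A0)" by (rule up[OF t t_lab[OF that(1)]])
      then show False using tW by blast
    qed
    have nmem: "\<not> g u \<epsilon> y" if "u \<in> B" "y \<in> A0" for u y
    proof
      assume "g u \<epsilon> y"
      then have "g u \<in> ?up A0" by (rule up[OF g(1)[OF that(1)] _ that(2)])
      then have "lab u \<in> ?up (?up A0)" by (rule up[OF labU lab_g, OF that(1) that(1)])
      then have "t \<in> ?up (?up (?up A0))" by (rule up[OF t t_lab[OF that(1)]])
      then show False using tW by blast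
    qed
    have g_ne_t: "g u \<noteq> t" if "u \<in> B" for u
      using russ[OF labU[OF that]] lab_g[OF that] t_lab[OF that] by metis
    have t_notin: "\<not> t \<epsilon> y" if "y \<in> A0" for y using up[OF t _ that] tW by blast
    have lab_ne_g: "lab u \<noteq> g v" if uv: "u \<in> B" "v \<in> B" for u v
    proof
      assume "lab u = g v"
      then have "lab v \<epsilon> lab u" using lab_g[OF uv(2)] by simp
      then consider "lab v = u" | "lab v = t" using ext_lab[OF uv(1) labU[OF uv(2)]] by blast
      then show False
      proof cases
        case 1
        have "u \<in> A0" using uv(1) by (simp add: A0_def)
        then show ?thesis using 1 t_lab[OF uv(2)] t_notin by metis
      next
        case 2
        then show ?thesis using t_lab[OF uv(2)] russ[OF t] by metis
      qed
    qed
    have lab_A0: "lab u \<notin> A0" if "u \<in> B" for u using t_notin t_lab[OF that] by blast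
    have sub: "A \<subseteq> A0" "B \<subseteq> A0" by (auto simp: A0_def)
    \<comment> \<open>Labels are neither copies nor members of \<open>A0\<close>, so
      \<open>lab u\<close> is the only label in \<open>g u\<close>, and it determines
      \<open>u\<close>.\<close>
    have g_inj: "u = v" if "u \<in> B" "v \<in> B" "g u = g v" for u v
    proof -
      have "lab u \<epsilon> g v" using lab_g[OF that(1)] that(3) by simp
      then have "(\<exists>w\<in>B. w \<epsilon> v \<and> lab u = g w) \<or> lab u \<in> A \<and> R v (lab u) \<or> lab u = lab v"
        using mem_g[OF that(2) labU[OF that(1)]] by simp
      then have "lab u = lab v" using lab_ne_g[OF that(1)] lab_A0[OF that(1)] sub by blast
      then show ?thesis using lab_inj that by simp
    qed
    have gg: "g u \<epsilon> g v \<longleftrightarrow> u \<epsilon> v" if "u \<in> B" "v \<in> B" for u v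
    proof -
      have "g u \<notin> A" using ne[OF that(1)] sub by blast
      moreover have "g u \<noteq> lab v" using lab_ne_g[OF that(2,1)] by metis
      ultimately have "g u \<epsilon> g v \<longleftrightarrow> (\<exists>w\<in>B. w \<epsilon> v \<and> g u = g w)"
        using mem_g[OF that(2) g(1)[OF that(1)]] by simp
      also have "\<dots> \<longleftrightarrow> u \<epsilon> v" using g_inj[OF that(1)] that(1) by metis
      finally show ?thesis .
    qed
    show thesis
    proof (rule that)
      show "inj_on g B" using g_inj by (auto simp: inj_on_def)
      show "y \<noteq> g u" if "u \<in> B" "y \<in> A" for u y using ne that sub by blast
      show "\<not> g u \<epsilon> y" if "u \<in> B" "y \<in> A" for u y using nmem that sub by blast
      show "y \<epsilon> g u \<longleftrightarrow> R u y" if "u \<in> B" "y \<in> A" for u y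
      proof -
        have "y \<in> U" using that AU by blast
        moreover have "y \<noteq> lab u" using lab_A0[OF that(1)] that(2) sub by blast
        moreover have "y \<noteq> g v" if "v \<in> B" for v using ne[OF that] \<open>y \<in> A\<close> sub by blast
        ultimately show ?thesis using mem_g[OF that(1)] that(2) by metis
      qed
      show "y \<in> g ` B" if "u \<in> B" "y \<in> U" "Dr (g u) y" for u y
      proof -
        \<comment> \<open>The label is an element of \<open>g u\<close> outside the copy, so a
          \<open>D\<close>-edge to it has to be excluded: its elements are \<open>u\<close> and
          \<open>t\<close>, and neither is \<open>g u\<close>.\<close>
        have "\<not> g u \<epsilon> lab u"
        proof
          assume "g u \<epsilon> lab u"
          then have "g u = u" using ext_lab[OF that(1) g(1)[OF that(1)]] g_ne_t[OF that(1)] by blast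
          then show False using ne[OF that(1), of u] that(1) sub by auto
        qed
        then have "y \<noteq> lab u" using that(3) by metis
        moreover have "y \<notin> A" using nmem[OF that(1)] that(3) sub by blast
        ultimately show ?thesis using mem_g[OF that(1,2)] that(3) by blast
      qed
    qed (use g(1,3) gg in auto)
  qed
qed

text \<open>The ball of radius \<open>r'\<close> about \<open>a\<close> is so far from
  \<open>P r'\<close> that no \<open>D\<close>-edges join the two. The remaining
  \<open>S\<close>-edges are reproduced by a fresh copy over \<open>Q r'\<close>, after which
  \<open>h\<close> and the copying map are glued.\<close>

lemma match_far:
  assumes m: "match r P Q h" and r': "2 * r' + 1 \<le> r" and a: "a \<in> U" "a \<notin> P (2 * r' + 1)"
  obtains P' Q' h' where "match r' P' Q' h'" "P 0 \<subseteq> P' 0" "a \<in> P' 0" "\<And>x. x \<in> P 0 \<Longrightarrow> h' x = h x"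
    "bounded_comp (h' a)"
proof -
  define N where "N = ball {a}"
  have "small {a}" using small_pair[OF a(1) a(1)] by simp
  then have N: "small (N i)" for i unfolding N_def by (rule small_ball)
  have N_Suc: "N (Suc i) = N i \<union> {y \<in> U. \<exists>x\<in>N i. Dr x y}" for i by (simp add: N_def)
  have N_mono: "N i \<subseteq> N j" if "i \<le> j" for i j unfolding N_def using that by (rule ball_mono)
  have aN: "a \<in> N i" for i using N_mono[of 0 i] by (simp add: N_def)
  have disj: "N i \<inter> P j = {}" if "i + j \<le> 2 * r' + 1" for i j
    unfolding N_def using match_disjoint_ball[OF m r' a that] .
  have r'r: "r' \<le> r" "r' < r" using r' by auto
  note mD = matchD[OF m]
  have Pr: "P r' \<subseteq> P r" using match_mono[OF m r'r(1)] by simp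
  have P_mono: "P i \<subseteq> P r'" "Q i \<subseteq> Q r'" if "i \<le> r'" for i
    using match_mono[OF m that r'r(1)] match_mono[OF match_sym[OF m] that r'r(1)] by auto
  \<comment> \<open>An \<open>S\<close>-edge of either direction between \<open>u\<close> and
    \<open>x\<close> becomes membership of \<open>h x\<close> in \<open>g u\<close>, as
    \<open>S\<close> forgets the direction.\<close>
  have dR: "dfn2 (\<lambda>u y. \<exists>x\<in>P r'. (x \<in> P r \<and> y = h x) \<and> Sr u x)"
    unfolding dfn2_def by (intro dfn_bex mD(1) r'r dfn_conj dfn_disj dfn_mem dfn2_app[OF mD(10)] trm_var)
  show thesis
  proof (rule fresh_copy[OF N mD(2)[OF r'r(1)] dR])
    fix g assume gU: "\<And>u. u \<in> N r' \<Longrightarrow> g u \<in> U" and dg: "dfn2 (\<lambda>u y. u \<in> N r' \<and> y = g u)"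
      and gi: "inj_on g (N r')"
      and g_ne: "\<And>u y. u \<in> N r' \<Longrightarrow> y \<in> Q r' \<Longrightarrow> y \<noteq> g u"
      and g_nmem: "\<And>u y. u \<in> N r' \<Longrightarrow> y \<in> Q r' \<Longrightarrow> \<not> g u \<epsilon> y"
      and g_R: "\<And>u y. u \<in> N r' \<Longrightarrow> y \<in> Q r' \<Longrightarrow>
          y \<epsilon> g u \<longleftrightarrow> (\<exists>x\<in>P r'. (x \<in> P r \<and> y = h x) \<and> Sr u x)"
      and gg: "\<And>u v. u \<in> N r' \<Longrightarrow> v \<in> N r' \<Longrightarrow> g u \<epsilon> g v \<longleftrightarrow> u \<epsilon> v"
      and g_D: "\<And>u y. u \<in> N r' \<Longrightarrow> y \<in> U \<Longrightarrow> Dr (g u) y \<Longrightarrow> y \<in> g ` N r'"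
    have hQ: "h x \<in> Q r'" if "x \<in> P r'" for x using mD(3)[OF r'r(1)] that by blast
    have gh: "h x \<epsilon> g u \<longleftrightarrow> Sr u x" if "u \<in> N r'" "x \<in> P r'" for u x
    proof -
      have "h x = h x' \<longleftrightarrow> x = x'" if "x' \<in> P r'" for x'
        using inj_on_eq_iff[OF mD(7)] Pr that \<open>x \<in> P r'\<close> by blast
      then show ?thesis using g_R[OF that(1) hQ[OF that(2)]] that(2) Pr by blast
    qed
    \<comment> \<open>This accounts for the bound \<open>2 * r' + 1\<close>: \<open>N r'\<close> has
      to miss \<open>P (Suc r')\<close>, not only \<open>P r'\<close>.\<close>
    have nD: "\<not> Dr x u" if "u \<in> N r'" "x \<in> P r'" for u x
    proof
      assume "Dr x u"
      then have "u \<in> P (Suc r')"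
        using mD(5)[OF r'r(2) that(2)] small_subset_U[OF N] that(1) by blast
      then show False using disj[of r' "Suc r'"] that by auto
    qed
    have N_nbr: "v \<in> N (Suc i)" if "i < r'" "u \<in> N i" "v \<in> N r'" "Dr (g u) (g v)" for i u v
    proof -
      have "u \<in> N r'" using N_mono[of i r'] that by auto
      then have "Dr u v" using gg that(3,4) by blast
      then show ?thesis unfolding N_Suc using that small_subset_U[OF N] by blast
    qed
    define h' where "h' x = (if x \<in> N r' then g x else h x)" for x
    have h'N: "h' x = g x" if "x \<in> N r'" for x using that by (simp add: h'_def)
    have h'P: "h' x = h x" if "x \<in> P r'" for x using that disj[of r' r'] by (auto simp: h'_def)
    let ?P = "\<lambda>i. P i \<union> N i" and ?Q = "\<lambda>i. Q i \<union> g ` N i"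
    have S1: "Sr x y \<longleftrightarrow> Sr (h' x) (h' y)" and D1: "Dr x y \<longleftrightarrow> Dr (h' x) (h' y)"
      if "x \<in> P r'" "y \<in> N r'" for x y
      using gh[OF that(2,1)] g_nmem[OF that(2) hQ[OF that(1)]] nD[OF that(2,1)] h'N[OF that(2)] h'P[OF that(1)]
      by auto
    have S: "Sr x y \<longleftrightarrow> Sr (h' x) (h' y)" and D: "Dr x y \<longleftrightarrow> Dr (h' x) (h' y)"
      if xy: "x \<in> ?P r'" "y \<in> ?P r'" for x y
    proof -
      consider "x \<in> P r'" "y \<in> P r'" | "x \<in> P r'" "y \<in> N r'" | "y \<in> P r'" "x \<in> N r'" | "x \<in> N r'" "y \<in> N r'"
        using xy by blast
      then have "(Sr x y \<longleftrightarrow> Sr (h' x) (h' y)) \<and> (Dr x y \<longleftrightarrow> Dr (h' x) (h' y))"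
      proof cases
        case 1
        then have "x \<in> P r" "y \<in> P r" using Pr by auto
        then show ?thesis using mD(8)[of x y] mD(9)[of x y] by (simp only: h'P 1)
      next
        case 2
        then show ?thesis using S1 D1 by blast
      next
        case 3
        then show ?thesis using S1[of y x] D1[of y x] by blast
      next
        case 4
        then show ?thesis using gg by (simp only: h'N 4)
      qed
      then show "Sr x y \<longleftrightarrow> Sr (h' x) (h' y)" "Dr x y \<longleftrightarrow> Dr (h' x) (h' y)" by blast+
    qed
    have match': "match r' ?P ?Q h'"
    proof (rule matchI)
      fix i assume i: "i \<le> r'"
      then have ir: "i \<le> r" using r'r by simp
      show "small (P i \<union> N i)" by (intro small_Un N mD(1) ir)
      have "small (g ` N i)"
        by (rule small_image[OF N dg N_mono[OF i]]) (use gU N_mono[OF i] in blast)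
      then show "small (Q i \<union> g ` N i)" by (intro small_Un mD(2) ir)
      have "h' ` P i = h ` P i" by (rule image_cong) (use h'P P_mono[OF i] in auto)
      moreover have "h' ` N i = g ` N i" by (rule image_cong) (use h'N N_mono[OF i] in auto)
      ultimately show "h' ` (P i \<union> N i) = Q i \<union> g ` N i" using mD(3)[OF ir] by (simp add: image_Un)
    next
      fix i assume i: "i < r'"
      then have ir: "i < r" using r'r by simp
      show "P i \<union> N i \<subseteq> P (Suc i) \<union> N (Suc i)" using mD(4)[OF ir] N_mono[of i "Suc i"] by auto
      fix x y assume y: "y \<in> U" "Dr x y"
      show "y \<in> P (Suc i) \<union> N (Suc i)" if "x \<in> P i \<union> N i"
      proof (cases "x \<in> P i")
        case True
        then show ?thesis using mD(5)[OF ir True y] by blast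
      next
        case False
        then show ?thesis using that y unfolding N_Suc by blast
      qed
      show "y \<in> Q (Suc i) \<union> g ` N (Suc i)" if "x \<in> Q i \<union> g ` N i"
      proof (cases "x \<in> Q i")
        case True
        then show ?thesis using mD(6)[OF ir True y] by blast
      next
        case False
        with that obtain u where u: "u \<in> N i" "x = g u" by blast
        then have "u \<in> N r'" using N_mono[of i r'] i by auto
        then obtain v where v: "v \<in> N r'" "y = g v" using g_D[of u y] y u by blast
        then have "v \<in> N (Suc i)" using N_nbr[OF i u(1) v(1)] y u v by blast
        then show ?thesis using v by blast
      qed
    next
      show "inj_on h' (P r' \<union> N r')"
      proof (rule inj_onI)
        fix x y assume xy: "x \<in> P r' \<union> N r'" "y \<in> P r' \<union> N r'" "h' x = h' y"
        consider "x \<in> P r'" "y \<in> P r'" | "x \<in> P r'" "y \<in> N r'" | "y \<in> P r'" "x \<in> N r'" | "x \<in> N r'" "y \<in> N r'"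
          using xy by blast
        then show "x = y"
        proof cases
          case 1
          then show ?thesis using xy(3) inj_onD[OF mD(7)] Pr by (auto simp: h'P)
        next
          case 2
          then show ?thesis using xy(3) g_ne[OF 2(2) hQ[OF 2(1)]] by (simp add: h'P h'N)
        next
          case 3
          then show ?thesis using xy(3) g_ne[OF 3(2) hQ[OF 3(1)]] by (simp add: h'P h'N)
        next
          case 4
          then show ?thesis using xy(3) inj_onD[OF gi] by (simp add: h'N)
        qed
      qed
      have "dfn2 (\<lambda>x y. (x \<in> N r' \<and> y = g x) \<or> (x \<in> P r' \<and> (x \<in> P r \<and> y = h x)))"
        unfolding dfn2_def
        by (intro dfn_disj dfn_conj[OF dfn_in[OF mD(1)[OF r'r(1)]]] dfn2_app[OF mD(10)] dfn2_app[OF dg] trm_var)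
      moreover have "(x \<in> N r' \<and> y = g x) \<or> (x \<in> P r' \<and> (x \<in> P r \<and> y = h x)) \<longleftrightarrow>
          x \<in> P r' \<union> N r' \<and> y = h' x" for x y
        using Pr h'P[of x] h'N[of x] by (cases "x \<in> N r'"; cases "x \<in> P r'") auto
      ultimately show "dfn2 (\<lambda>x y. x \<in> P r' \<union> N r' \<and> y = h' x)" by simp
    qed (use S D in blast)+
    have bounded: "bounded_comp (h' a)"
    proof -
      have g_Suc: "{y \<in> U. \<exists>x\<in>g ` N i. Dr x y} \<subseteq> g ` (N (Suc i) \<inter> N r')" if "i \<le> r'" for i
      proof
        fix y assume "y \<in> {y \<in> U. \<exists>x\<in>g ` N i. Dr x y}"
        then obtain u where u: "u \<in> N i" "Dr (g u) y" "y \<in> U" by blast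
        then have uN: "u \<in> N r'" using N_mono[OF that] by blast
        then obtain v where v: "v \<in> N r'" "y = g v" using g_D[OF uN u(3,2)] by blast
        then have "Dr u v" using u gg[OF uN v(1)] gg[OF v(1) uN] by simp
        then have "v \<in> N (Suc i)" unfolding N_Suc using u(1) v(1) small_subset_U[OF N] by blast
        then show "y \<in> g ` (N (Suc i) \<inter> N r')" using v by blast
      qed
      \<comment> \<open>The centre is \<open>g a\<close> and the radius \<open>r'\<close>. Up to
        \<open>r'\<close> the balls about \<open>g a\<close> are the images of those about
        \<open>a\<close>; there the copy ends, since it contains its \<open>D\<close>-neighbours,
        even if the component of \<open>a\<close> continues.\<close>
      have ball_g: "ball {g a} i = g ` N i" if "i \<le> r'" for i
        using that
      proof (induction i)
        case 0
        then show ?case by (simp add: N_def)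
      next
        case (Suc i)
        have "g ` N (Suc i) \<subseteq> g ` N i \<union> {y \<in> U. \<exists>x\<in>g ` N i. Dr x y}"
        proof
          fix y assume "y \<in> g ` N (Suc i)"
          then obtain v where v: "v \<in> N (Suc i)" "y = g v" by blast
          then have vN: "v \<in> N r'" using N_mono[OF Suc.prems] by blast
          show "y \<in> g ` N i \<union> {y \<in> U. \<exists>x\<in>g ` N i. Dr x y}"
          proof (cases "v \<in> N i")
            case True
            then show ?thesis using v by blast
          next
            case False
            then obtain u where u: "u \<in> N i" "Dr u v" using v(1) N_Suc by blast
            then have uN: "u \<in> N r'" using N_mono[of i r'] Suc.prems by auto
            have "Dr (g u) (g v)" using gg[OF uN vN] gg[OF vN uN] u by simp
            then show ?thesis using v gU[OF vN] u(1) by blast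
          qed
        qed
        moreover have "N i \<subseteq> N (Suc i)" by (rule N_mono) simp
        ultimately have "g ` N i \<union> {y \<in> U. \<exists>x\<in>g ` N i. Dr x y} = g ` N (Suc i)"
          using g_Suc[of i] Suc.prems by auto
        then show ?case using Suc by simp
      qed
      have "ball {g a} (Suc r') \<subseteq> ball {g a} r'"
        using g_Suc[of r'] ball_g[of r'] by auto
      moreover have "g a \<in> ball {g a} r'" using ball_g[of r'] aN by blast
      ultimately show ?thesis unfolding bounded_comp_def using h'N[OF aN] gU[OF aN] by metis
    qed
    show thesis
    proof (rule that[OF match' _ _ _ bounded])
      show "h' x = h x" if "x \<in> P 0" for x using h'P P_mono(1)[of 0] that by blast
    qed (use aN in auto)
  qed
qed

text \<open>If \<open>a\<close> lies in \<open>P (2 * r' + 1)\<close>, the chains shifted by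
  \<open>2 * r' + 1\<close> must still reach \<open>r'\<close> further, which gives the bound
  \<open>3 * r' + 1\<close>; otherwise \<open>a\<close> is far and gets copied.\<close>

lemma match_extend:
  assumes m: "match r P Q h" and r': "3 * r' + 1 \<le> r" and a: "a \<in> U"
  obtains P' Q' h' where "match r' P' Q' h'" "P 0 \<subseteq> P' 0" "a \<in> P' 0" "\<And>x. x \<in> P 0 \<Longrightarrow> h' x = h x"
proof (cases "a \<in> P (2 * r' + 1)")
  case True
  have "match r' (\<lambda>i. P (2 * r' + 1 + i)) (\<lambda>i. Q (2 * r' + 1 + i)) h"
    by (rule match_near[OF m]) (use r' in simp)
  moreover have "P 0 \<subseteq> P (2 * r' + 1)" by (rule match_mono[OF m]) (use r' in simp_all)
  ultimately show thesis using that True by simp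
next
  case False
  have "2 * r' + 1 \<le> r" using r' by simp
  from match_far[OF m this a False] that show thesis by metis
qed

text \<open>Instead of the quantifier depth, this counts the radius that \<open>match_extend\<close>
  consumes at each quantifier.\<close>

primrec rank :: "'r fm \<Rightarrow> nat" where
  "rank (Rel r i j) = 0"
| "rank (Eq i j) = 0"
| "rank (Neg p) = rank p"
| "rank (Conj p q) = max (rank p) (rank q)"
| "rank (Forall p) = 3 * rank p + 1"

text \<open>A match is a position of the Ehrenfeucht-Fraisse game, and its length \<open>r\<close>
  limits the formulas on which both sides still agree.\<close>

lemma match_sat:
  assumes "match r P Q h" "rank p \<le> r" "\<And>n. n \<in> fv p \<Longrightarrow> e n \<in> P 0 \<and> e' n = h (e n)"
  shows "sat (sd_graph M) e p \<longleftrightarrow> sat (sd_graph M) e' p"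
  using assms
proof (induction p arbitrary: r P Q h e e')
  case (Rel s i j)
  have "P 0 \<subseteq> P r" by (rule match_mono[OF Rel.prems(1)]) simp_all
  then have "e i \<in> P r" "e j \<in> P r" "e' i = h (e i)" "e' j = h (e j)" using Rel.prems(3) by auto
  then show ?case
    using matchD(8)[OF Rel.prems(1), of "e i" "e j"] matchD(9)[OF Rel.prems(1), of "e i" "e j"]
    by (cases s) (simp_all add: sd_graph_def)
next
  case (Eq i j)
  have "P 0 \<subseteq> P r" by (rule match_mono[OF Eq.prems(1)]) simp_all
  then have "e i \<in> P r" "e j \<in> P r" "e' i = h (e i)" "e' j = h (e j)" using Eq.prems(3) by auto
  then show ?case using inj_on_eq_iff[OF matchD(7)[OF Eq.prems(1)], of "e i" "e j"] by simp
next
  case (Neg p)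
  have "sat (sd_graph M) e p \<longleftrightarrow> sat (sd_graph M) e' p"
    by (rule Neg.IH[OF Neg.prems(1)]) (use Neg.prems(2,3) in auto)
  then show ?case by simp
next
  case (Conj p q)
  have "sat (sd_graph M) e p \<longleftrightarrow> sat (sd_graph M) e' p"
    by (rule Conj.IH(1)[OF Conj.prems(1)]) (use Conj.prems(2,3) in auto)
  moreover have "sat (sd_graph M) e q \<longleftrightarrow> sat (sd_graph M) e' q"
    by (rule Conj.IH(2)[OF Conj.prems(1)]) (use Conj.prems(2,3) in auto)
  ultimately show ?case by simp
next
  case (Forall p)
  \<comment> \<open>An arbitrary match is allowed here, so that the inverse of \<open>h\<close>
    gives the other direction.\<close>
  have forth: "\<exists>b\<in>U. sat (sd_graph M) (case_nat a e) p \<longleftrightarrow> sat (sd_graph M) (case_nat b e') p"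
    if m: "match r P Q h" and e: "\<And>n. n \<in> fv (Forall p) \<Longrightarrow> e n \<in> P 0 \<and> e' n = h (e n)" and a: "a \<in> U"
    for P Q h e e' a
  proof -
    have "3 * rank p + 1 \<le> r" using Forall.prems(2) by simp
    from match_extend[OF m this a] obtain P' Q' h' where
      m': "match (rank p) P' Q' h'" and P': "P 0 \<subseteq> P' 0" "a \<in> P' 0" "\<And>x. x \<in> P 0 \<Longrightarrow> h' x = h x" by metis
    have "sat (sd_graph M) (case_nat a e) p \<longleftrightarrow> sat (sd_graph M) (case_nat (h' a) e') p"
    proof (rule Forall.IH[OF m' order_refl])
      fix n assume "n \<in> fv p"
      then show "case_nat a e n \<in> P' 0 \<and> case_nat (h' a) e' n = h' (case_nat a e n)"
        using P' e by (cases n) auto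
    qed
    moreover have "h' a \<in> U"
      using small_subset_U[OF matchD(2)[OF m', of 0]] matchD(3)[OF m', of 0] P'(2) by blast
    ultimately show ?thesis by blast
  qed
  have inj: "inj_on h (P r)" and sub: "P 0 \<subseteq> P r"
    using matchD(7)[OF Forall.prems(1)] match_mono[OF Forall.prems(1), of 0 r] by auto
  have inv_e: "e' n \<in> Q 0 \<and> e n = inv_into (P r) h (e' n)" if "n \<in> fv (Forall p)" for n
    using Forall.prems(3)[OF that] matchD(3)[OF Forall.prems(1), of 0] inv_into_f_f[OF inj] sub
    by (metis image_eqI le0 subsetD)
  have U: "universe (sd_graph M) = U" by (simp add: sd_graph_def)
  show ?case unfolding sat.simps U
    using forth[OF Forall.prems(1,3)] forth[OF match_sym[OF Forall.prems(1)] inv_e] by meson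
qed

end

section \<open>The part of the SD-graph with bounded \<open>D\<close>-components\<close>

lemma relpow_sym: "sym R \<Longrightarrow> (x, y) \<in> R ^^ k \<Longrightarrow> (y, x) \<in> R ^^ k"
proof (induction k arbitrary: y)
  case (Suc k)
  then obtain w where "(x, w) \<in> R ^^ k" "(w, y) \<in> R" by auto
  then have "(y, w) \<in> R" "(w, x) \<in> R ^^ k" using Suc by (auto dest: symD)
  then have "(y, x) \<in> R O R ^^ k" by blast
  then show ?case by (simp add: relpow_commute)
qed simp

context zfa_model begin

definition bounded_part :: "(sd, 'a) struc" where
  "bounded_part = sd_graph M\<lparr>universe := {x \<in> U. bounded_comp x}\<rparr>"

text \<open>The centre and radius for \<open>x\<close> serve \<open>y\<close> too, as the ball is
  closed under \<open>D\<close>.\<close>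

lemma bounded_comp_nbr:
  assumes "bounded_comp x" "y \<in> U" "Dr x y"
  shows "bounded_comp y"
proof -
  obtain z n where z: "z \<in> U" "x \<in> ball {z} n" "ball {z} (Suc n) \<subseteq> ball {z} n"
    using assms by (auto simp: bounded_comp_def)
  then have "y \<in> ball {z} (Suc n)" using assms by auto
  then show ?thesis unfolding bounded_comp_def using z by blast
qed

lemma bounded_comp_ball: "y \<in> ball A n \<Longrightarrow> (\<And>x. x \<in> A \<Longrightarrow> bounded_comp x) \<Longrightarrow> bounded_comp y"
proof (induction n arbitrary: y)
  case (Suc n)
  then show ?case using bounded_comp_nbr by auto
qed simp

text \<open>This is the starting position when both tuples are the same, as in the Tarski-Vaught
  criterion.\<close>

lemma match_refl:
  assumes "small A"
  shows "match r (ball A) (ball A) (\<lambda>x. x)"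
proof (rule matchI)
  show "ball A i \<subseteq> ball A (Suc i)" for i by auto
  show "dfn2 (\<lambda>x y. x \<in> ball A r \<and> y = x)"
    unfolding dfn2_def by (intro dfn_conj dfn_in small_ball assms dfn_eq trm_var)
qed (use small_ball[OF assms] in auto)

lemma bounded_part_elementary:
  assumes "range e \<subseteq> universe bounded_part"
  shows "sat bounded_part e p \<longleftrightarrow> sat (sd_graph M) e p"
  unfolding bounded_part_def
proof (rule tarski_vaught)
  show "{x \<in> U. bounded_comp x} \<subseteq> universe (sd_graph M)" by (auto simp: sd_graph_def)
  show "range e \<subseteq> {x \<in> U. bounded_comp x}" using assms by (simp add: bounded_part_def)
  fix p :: "sd fm" and e :: "nat \<Rightarrow> 'a" and a
  assume e: "range e \<subseteq> {x \<in> U. bounded_comp x}" and a: "a \<in> universe (sd_graph M)"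
    and sat: "sat (sd_graph M) (case_nat a e) p"
  have aU: "a \<in> U" using a by (simp add: sd_graph_def)
  \<comment> \<open>Only the values at free variables of \<open>p\<close> count; being finitely
    many, they form a set of the model.\<close>
  define A where "A = e ` {n. Suc n \<in> fv p}"
  have "{n. Suc n \<in> fv p} = Suc -` fv p" by auto
  then have "finite A" unfolding A_def using finite_fv[of p] by (simp add: finite_vimageI)
  moreover have AU: "A \<subseteq> U" using e by (auto simp: A_def)
  ultimately have A: "small A"
    by (induction A rule: finite_induct) (auto simp: small_empty small_insert)
  have bA: "bounded_comp x" if "x \<in> A" for x using e that by (auto simp: A_def)
  \<comment> \<open>In contrast to \<open>match_extend\<close>, no shift of the chains has to be
    paid for: a point \<open>a\<close> near \<open>A\<close> lies in a component of finite radius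
    and is its own witness.\<close>
  let ?r = "2 * rank p + 1"
  show "\<exists>b\<in>{x \<in> U. bounded_comp x}. sat (sd_graph M) (case_nat b e) p"
  proof (cases "a \<in> ball A ?r")
    case True
    then have "bounded_comp a" using bounded_comp_ball bA by blast
    then show ?thesis using aU sat by blast
  next
    case False
    show ?thesis
    proof (rule match_far[OF match_refl[OF A] order_refl aU False])
      fix P' Q' h' assume m: "match (rank p) P' Q' h'" and P': "ball A 0 \<subseteq> P' 0" "a \<in> P' 0"
        and h': "\<And>x. x \<in> ball A 0 \<Longrightarrow> h' x = x" and b: "bounded_comp (h' a)"
      have "sat (sd_graph M) (case_nat a e) p \<longleftrightarrow> sat (sd_graph M) (case_nat (h' a) e) p"
      proof (rule match_sat[OF m order_refl])
        fix n assume n: "n \<in> fv p"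
        show "case_nat a e n \<in> P' 0 \<and> case_nat (h' a) e n = h' (case_nat a e n)"
        proof (cases n)
          case (Suc k)
          then have "e k \<in> A" using n by (auto simp: A_def)
          then show ?thesis using P'(1) h' Suc by auto
        qed (simp add: P'(2))
      qed
      moreover have "h' a \<in> U"
        using small_subset_U[OF matchD(2)[OF m, of 0]] matchD(3)[OF m, of 0] P'(2) by blast
      ultimately show ?thesis using sat b by blast
    qed
  qed
qed

text \<open>The empty set has no elements, hence no \<open>D\<close>-neighbours, and radius 0
  suffices.\<close>

lemma bounded_part_nonempty: "universe bounded_part \<noteq> {}"
proof -
  have "mk {} \<in> U" by (rule mk_in_U[OF small_empty])
  moreover have "ball {mk {}} (Suc 0) \<subseteq> ball {mk {}} 0"
    using mem_mk[OF small_empty] by auto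
  ultimately have "bounded_comp (mk {})"
    unfolding bounded_comp_def by (intro bexI[of _ "mk {}"] exI[of _ 0]) simp_all
  then show ?thesis using \<open>mk {} \<in> U\<close> by (auto simp: bounded_part_def)
qed

lemma edges_bounded_part:
  "(x, y) \<in> edges bounded_part D_rel \<longleftrightarrow> x \<in> U \<and> y \<in> U \<and> bounded_comp x \<and> bounded_comp y \<and> Dr x y"
  by (auto simp: edges_def bounded_part_def sd_graph_def)

lemma sym_edges_bounded_part: "sym (edges bounded_part D_rel)"
  by (auto simp: sym_def edges_bounded_part)

text \<open>Balls are taken in the whole model, paths only in the bounded part. As the bounded part
  is closed under \<open>D\<close>, a path starting at \<open>z\<close> never leaves it.\<close>

lemma path_in_ball:
  assumes "z \<in> U" "bounded_comp z" "y \<in> ball {z} n"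
  shows "\<exists>k\<le>n. (z, y) \<in> edges bounded_part D_rel ^^ k"
  using assms(3)
proof (induction n arbitrary: y)
  case 0
  then show ?case by simp
next
  case (Suc n)
  show ?case
  proof (cases "y \<in> ball {z} n")
    case True
    then show ?thesis using Suc.IH[OF True] le_SucI by blast
  next
    case False
    then obtain x where x: "x \<in> ball {z} n" "y \<in> U" "Dr x y" using Suc.prems by auto
    have "small {z}" using small_pair[OF assms(1) assms(1)] by simp
    then have "x \<in> U" using small_subset_U[OF small_ball] x(1) by blast
    moreover have bx: "bounded_comp x" using bounded_comp_ball[OF x(1)] assms(2) by blast
    moreover have "bounded_comp y" using bounded_comp_nbr[OF bx x(2,3)] .
    ultimately have "(x, y) \<in> edges bounded_part D_rel" using x by (simp add: edges_bounded_part)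
    moreover obtain k where "k \<le> n" "(z, x) \<in> edges bounded_part D_rel ^^ k" using Suc.IH[OF x(1)] by blast
    ultimately have "Suc k \<le> Suc n \<and> (z, y) \<in> edges bounded_part D_rel ^^ Suc k" by auto
    then show ?thesis by blast
  qed
qed

text \<open>Any two points of the component are joined through the centre \<open>z\<close>, so the
  diameter is at most twice the radius.\<close>

lemma bounded_part_diameter:
  assumes "C \<in> graph_components (universe bounded_part) (edges bounded_part D_rel)"
  shows "graph_diameter (edges bounded_part D_rel) C \<noteq> \<infinity>"
proof -
  let ?E = "edges bounded_part D_rel"
  obtain x where x: "x \<in> U" "bounded_comp x" and C: "C = ?E\<^sup>* `` {x}"
    using assms by (auto simp: graph_components_def quotient_def bounded_part_def)
  obtain z n where z: "z \<in> U" "x \<in> ball {z} n" "ball {z} (Suc n) \<subseteq> ball {z} n"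
    using x(2) by (auto simp: bounded_comp_def)
  \<comment> \<open>Paths are counted from the centre, which therefore has to lie in the bounded
    part as well.\<close>
  have zb: "bounded_comp z"
    unfolding bounded_comp_def using z(1,3) ball_mono[of 0 n "{z}"] by (intro bexI[of _ z] exI[of _ n]) auto
  have ball: "y \<in> ball {z} n" if "y \<in> C" for y
  proof -
    have "(x, y) \<in> ?E\<^sup>*" using that C by blast
    then show ?thesis
    proof (induction rule: rtrancl_induct)
      case base
      then show ?case by (rule z(2))
    next
      case (step y w)
      then have "w \<in> ball {z} (Suc n)" by (auto simp: edges_bounded_part)
      then show ?case using z(3) by blast
    qed
  qed
  have "graph_dist ?E y w \<le> enat (2 * n)" if yw: "y \<in> C" "w \<in> C" for y w
  proof -
    obtain k where k: "k \<le> n" "(z, y) \<in> ?E ^^ k" using path_in_ball[OF z(1) zb ball[OF yw(1)]] by blast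
    obtain l where l: "l \<le> n" "(z, w) \<in> ?E ^^ l" using path_in_ball[OF z(1) zb ball[OF yw(2)]] by blast
    have "(y, z) \<in> ?E ^^ k"
      by (rule relpow_sym[OF sym_edges_bounded_part k(2)])
    then have "(y, w) \<in> ?E ^^ (k + l)" using l(2) by (auto simp: relpow_add)
    then have "graph_dist ?E y w \<le> enat (k + l)" unfolding graph_dist_def by (intro INF_lower) simp
    also have "\<dots> \<le> enat (2 * n)" using k(1) l(1) by simp
    finally show ?thesis .
  qed
  then have "graph_diameter ?E C \<le> enat (2 * n)"
    unfolding graph_diameter_def by (intro SUP_least)
  then show ?thesis by (cases "graph_diameter ?E C") simp_all
qed

end

theorem theorem4p16:
  fixes M :: "(mem, 'a) struc"
  assumes "universe M \<noteq> {}"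
    and "models M ZFA"
  shows "\<exists>N :: (sd, nat) struc.
    universe N \<noteq> {} \<and> countable (universe N) \<and>
    elem_equiv N (sd_graph M) \<and>
    (\<forall>C \<in> graph_components (universe N) (edges N D_rel). graph_diameter (edges N D_rel) C \<noteq> \<infinity>)"
proof (rule countable_elementary_submodel[OF assms(1)])
  fix K :: "(mem, nat) struc" and h
  assume K: "universe K \<noteq> {}" and h: "h ` universe K \<subseteq> universe M"
    and el: "\<And>p e. range e \<subseteq> universe K \<Longrightarrow> sat K e p \<longleftrightarrow> sat M (h \<circ> e) p"
  have he: "range (h \<circ> e) \<subseteq> universe M" if "range e \<subseteq> universe K" for e :: "nat \<Rightarrow> nat"
    using h that by auto
  have "models K ZFA"
    using assms(2) el he by (simp add: models_def true_in_def)
  moreover have "range (from_nat_into (universe K)) = universe K"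
    using K by (intro range_from_nat_into) simp_all
  \<comment> \<open>From here on \<open>bounded_part\<close> is formed in the countable model
    \<open>K\<close>, whose universe is a set of naturals; it is the structure
    \<open>N\<close>.\<close>
  ultimately interpret zfa_model K "from_nat_into (universe K)" by unfold_locales
  \<comment> \<open>A sentence has the same value under every environment, so the constant
    environment \<open>d\<close> is enough to compare the structures.\<close>
  obtain d where d: "d \<in> universe bounded_part" using bounded_part_nonempty by blast
  have dK: "d \<in> universe K" using d by (simp add: bounded_part_def)
  have "elem_equiv bounded_part (sd_graph M)"
    unfolding elem_equiv_def
  proof (intro allI impI)
    fix p :: "sd fm" assume p: "fv p = {}"
    have "true_in bounded_part p \<longleftrightarrow> sat bounded_part (\<lambda>_. d) p"
      using d by (intro true_in_sentence p) auto
    also have "\<dots> \<longleftrightarrow> sat (sd_graph K) (\<lambda>_. d) p"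
      using d by (intro bounded_part_elementary) auto
    also have "\<dots> \<longleftrightarrow> sat (sd_graph M) (h \<circ> (\<lambda>_. d)) p"
      unfolding sat_sd_graph using dK by (intro el) auto
    also have "\<dots> \<longleftrightarrow> true_in (sd_graph M) p"
      using dK h by (intro true_in_sentence[symmetric] p) (auto simp: sd_graph_def)
    finally show "true_in bounded_part p \<longleftrightarrow> true_in (sd_graph M) p" .
  qed
  then show ?thesis using bounded_part_nonempty bounded_part_diameter by (intro exI[of _ bounded_part]) auto
qed

end
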